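(* Let $n\in\mathbb{N}$ and let $C$ be a convex body in $\mathbb{R}^n$. There is an affine image $\widetilde C$ of $C$ with non-zero volume (that is, $\widetilde C = T(C)$ for some affine map $T:\mathbb{R}^n\to\mathbb{R}^n$, with $|\widetilde C|\neq 0$) such that for each unit vector $\theta\in\mathbb{R}^n$, $$|P_\theta \widetilde C| \ge |\widetilde C|^{\frac{n-1}{n}}.$$
   Context: A convex body in $\mathbb{R}^n$ is a compact convex set with non-empty interior (not assumed centrally symmetric). Unit vectors are taken with respect to the Euclidean norm. For a unit vector $\theta$, $P_\theta$ denotes the orthogonal projection of $\mathbb{R}^n$ onto the $1$-codimensional subspace perpendicular to $\theta$. $|\cdot|$ applied to a set denotes volume of the appropriate dimension: $|\widetilde C|$ is the $n$-dimensional volume and $|P_\theta\widetilde C|$ is the $(n-1)$-dimensional volume, in the hyperplane $\theta^\perp$, of the projection. *)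

theory Defs
  imports "HOL-Analysis.Analysis"
begin

definition convex_body :: "'a::euclidean_space set \<Rightarrow> bool" where
  "convex_body C \<longleftrightarrow> compact C \<and> convex C \<and> interior C \<noteq> {}"

definition affine_map :: "('a::real_vector \<Rightarrow> 'b::real_vector) \<Rightarrow> bool" where
  "affine_map T \<longleftrightarrow> (\<exists>f c. linear f \<and> T = (\<lambda>x. f x + c))"

definition perp :: "'a::real_inner \<Rightarrow> 'a set" where
  "perp \<theta> = {x. orthogonal \<theta> x}"

text \<open>The following formula is the orthogonal projection onto \<^term>\<open>perp \<theta>\<close> only for unit
  vectors \<^term>\<open>\<theta>\<close>.\<close>

definition proj_perp :: "'a::real_inner \<Rightarrow> 'a \<Rightarrow> 'a" where
  "proj_perp \<theta> x = x - (x \<bullet> \<theta>) *\<^sub>R \<theta>"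

lemma proj_perp_unique:
  assumes "norm \<theta> = 1"
  shows "y = proj_perp \<theta> x \<longleftrightarrow> y \<in> perp \<theta> \<and> (\<forall>z\<in>perp \<theta>. orthogonal (x - y) z)"
proof
  have 1: "\<theta> \<bullet> \<theta> = 1"
    using assms by (simp add: dot_square_norm)
  show "y \<in> perp \<theta> \<and> (\<forall>z\<in>perp \<theta>. orthogonal (x - y) z)" if "y = proj_perp \<theta> x"
    using that 1
    by (auto simp: proj_perp_def perp_def orthogonal_def inner_diff_right inner_commute)
  assume y: "y \<in> perp \<theta> \<and> (\<forall>z\<in>perp \<theta>. orthogonal (x - y) z)"
  define d where "d = proj_perp \<theta> x - y"
  have d: "d \<bullet> \<theta> = 0"
    using y 1 by (simp add: d_def proj_perp_def perp_def orthogonal_def inner_diff_left inner_diff_right inner_commute)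
  have "(x - y) \<bullet> d = 0"
    using y d by (simp add: perp_def orthogonal_def inner_commute)
  moreover have "x - y = d + (x \<bullet> \<theta>) *\<^sub>R \<theta>"
    by (simp add: d_def proj_perp_def)
  ultimately have "d \<bullet> d = 0"
    using d by (simp add: inner_add_left inner_add_right inner_commute)
  then show "y = proj_perp \<theta> x"
    by (simp add: d_def)
qed

definition orthonormal_basis_of :: "'a::euclidean_space set \<Rightarrow> 'a set \<Rightarrow> bool" where
  "orthonormal_basis_of S B \<longleftrightarrow>
     pairwise orthogonal B \<and> (\<forall>b\<in>B. norm b = 1) \<and> span B = S"

lemma orthonormal_basis_of_exists:
  assumes "subspace S"
  shows "\<exists>B. orthonormal_basis_of S B"
  using orthonormal_basis_subspace[OF assms] unfolding orthonormal_basis_of_def by metis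

text \<open>Lebesgue measure of dimension \<^term>\<open>dim S\<close> on a linear subspace \<^term>\<open>S\<close>, in the same way as
  the library introduces \<^const>\<open>lborel\<close> (see \<open>lborel_eq\<close>), with an orthonormal basis of
  \<^term>\<open>S\<close> in place of \<^const>\<open>Basis\<close>. By rotation invariance of Lebesgue measure the result does
  not depend on the choice of the basis. For the zero subspace the basis is empty and the measure
  is the point mass at \<open>0\<close>.\<close>

definition subspace_lborel :: "'a::euclidean_space set \<Rightarrow> 'a measure" where
  "subspace_lborel S =
     (let B = (SOME B. orthonormal_basis_of S B)
      in distr (\<Pi>\<^sub>M b\<in>B. lborel) borel (\<lambda>f. \<Sum>b\<in>B. f b *\<^sub>R b))"

end

theory Submission
  imports Defs
begin

text \<open>
  Write n for the dimension and h(z) for \<open>shadow C z\<close>, the volume that \<open>C\<close> gains when the segment from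
  0 to \<open>z\<close> is added to it. Slicing along lines parallel to a unit vector \<open>\<theta>\<close> gives h(\<theta>) = |P_\<theta> C|, and
  for a linear map \<open>F\<close> the function of the image \<open>F C\<close> is z \<mapsto> |det F| h(F^-1 z). The claim for \<open>T = F\<close>
  thus says that the unit ball K = {y. h(y) \<le> 1} of h, the polar projection body, lies inside an ellipsoid
  whose volume is not too large: it suffices that |F y|^2 \<le> n on K and |det F| \<ge> n^(n/2) |C|^(n-1).

  The ellipsoid is the smallest one around K, and it is found from the dual side. Among all convex
  combinations M = \<Sum> u_i y_i y_i^T with y_i in K take one of maximal determinant, and choose F with
  F M F^T = 1. Moving M a little towards y y^T does not increase the determinant, which says
  exactly that |F y|^2 \<le> n for y in K (\<open>optimal_design\<close>). What remains is an upper bound for det M = |det F|^-2.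

  This bound comes from the volume of the zonotope Z = \<Sum> [0, u_i y_i]. Minkowski's first inequality
  for C and Z, whose mixed volume is the sum of the h(u_i y_i) up to a factor, gives
  n^n |C|^(n-1) |Z| \<le> (\<Sum> u_i h(y_i))^n \<le> 1
  (\<open>minkowski_first_inequality_zonotope\<close>, from the Brunn--Minkowski inequality). In the other direction both
  |Z| and det M are polynomials in the u_i that are affine in each variable and
  homogeneous of degree n; their coefficients at an n-element set S of indices are |det Y_S| and
  (det Y_S)^2 for the matrix Y_S with columns y_i, i in S. The average of the y_i y_i^T over S competes with M,
  so (det Y_S)^2 \<le> n^n det M = W^2, and comparing coefficients gives det M \<le> W |Z|
  (\<open>det_le_vol_zonotope\<close>). The two bounds together are the required lower bound for |det F|. The unit cube shows
  that no constant is lost.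
\<close>

abbreviation vol :: "'a::euclidean_space set \<Rightarrow> real" where
  "vol \<equiv> measure lebesgue"

text \<open>As a rewrite rule \<open>measure_completion\<close> would turn the volume of every Borel set into a measure with
  respect to \<open>lborel\<close>, while the volumes of all other sets keep their form.\<close>

declare measure_completion [simp del]

section \<open>Volumes of linear images\<close>

text \<open>A shear is the identity matrix after one row operation.\<close>

lemma det_shear:
  fixes m n :: "'n::finite"
  assumes "m \<noteq> n"
  shows "det (matrix (\<lambda>x::real^'n. \<chi> i. if i = m then x$m + x$n else x$i)) = 1"
proof -
  have "matrix (\<lambda>x::real^'n. \<chi> i. if i = m then x$m + x$n else x$i)
      = (\<chi> k. if k = m then row m (mat 1) + 1 *s row n (mat 1) else row k (mat 1 :: real^'n^'n))"
    by (auto simp: matrix_def vec_eq_iff axis_def row_def mat_def)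
  then show ?thesis
    using det_row_operation[OF assms, where c = 1 and A = "mat 1 :: real^'n^'n"] by (simp only: det_I)
qed

text \<open>\<open>measure_shear_interval\<close> asks for a box on which the coordinate \<open>n\<close> is nonnegative. Translating the box
  changes its image only by a translation, so this is no restriction.\<close>

lemma measure_shear_cbox:
  fixes a b :: "real^'n"
  assumes "m \<noteq> n"
  shows "measure lebesgue ((\<lambda>x. \<chi> i. if i = m then x$m + x$n else x$i) ` cbox a b) = measure lebesgue (cbox a b)"
    (is "measure lebesgue (?h ` _) = _")
proof (cases "cbox a b = {}")
  case False
  define v :: "real^'n" where "v = (\<chi> i. if i = n then - a $ n else 0)"
  have ne: "cbox (v + a) (v + b) \<noteq> {}"
    using False by (simp add: cbox_translation)
  have lin: "linear ?h"
    by (rule linearI) (auto simp: vec_eq_iff algebra_simps)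
  have "?h ` cbox (v + a) (v + b) = (\<lambda>x. ?h v + x) ` ?h ` cbox a b"
    by (auto simp: cbox_translation image_image linear_add[OF lin])
  then have "measure lebesgue (?h ` cbox a b) = measure lebesgue (?h ` cbox (v + a) (v + b))"
    by (simp add: measure_translation)
  also have "\<dots> = measure lebesgue (cbox (v + a) (v + b))"
    by (rule measure_shear_interval[OF assms ne]) (simp add: v_def)
  also have "\<dots> = measure lebesgue (cbox a b)"
    unfolding cbox_translation by (rule measure_translation)
  finally show ?thesis .
qed simp

lemma measure_swap_cbox:
  fixes a b :: "real^'n"
  defines "h \<equiv> \<lambda>p (x::real^'n). \<chi> i. x $ p i"
  assumes p: "p permutes UNIV"
  shows "measure lebesgue (h p ` cbox a b) = measure lebesgue (cbox a b)"
proof -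
  have eq: "h p ` cbox a b = cbox (h p a) (h p b)"
  proof
    show "h p ` cbox a b \<subseteq> cbox (h p a) (h p b)"
      by (auto simp: h_def mem_box_cart)
    show "cbox (h p a) (h p b) \<subseteq> h p ` cbox a b"
    proof
      fix y assume "y \<in> cbox (h p a) (h p b)"
      then have y: "a $ p i \<le> y $ i \<and> y $ i \<le> b $ p i" for i
        by (auto simp: h_def mem_box_cart)
      have "h (inv p) y \<in> cbox a b"
        using y[of "inv p i" for i] permutes_inverses[OF p] by (auto simp: h_def mem_box_cart)
      moreover have "h p (h (inv p) y) = y"
        using permutes_inverses[OF p] by (simp add: h_def vec_eq_iff)
      ultimately show "y \<in> h p ` cbox a b" by (metis imageI)
    qed
  qed
  show ?thesis
  proof (cases "cbox a b = {}")
    case False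
    moreover have "cbox (h p a) (h p b) \<noteq> {}" using False eq by auto
    moreover have "(\<Prod>i\<in>UNIV. h p b $ i - h p a $ i) = (\<Prod>i\<in>UNIV. b $ i - a $ i)"
      using prod.permute[OF p, of "\<lambda>i. b $ i - a $ i"] by (simp add: h_def comp_def)
    ultimately show ?thesis
      unfolding eq by (simp add: measure_completion content_cbox_cart)
  qed simp
qed

text \<open>Both sides are multiplicative in \<open>f\<close>, which leaves the elementary maps. The index type carries no order: the determinant
  of a shear is computed by a row operation and not as that of a triangular matrix.\<close>

theorem measure_linear_image_det:
  fixes f :: "real^'n \<Rightarrow> real^'n"
  assumes "linear f" "S \<in> lmeasurable"
  shows "f ` S \<in> lmeasurable" "measure lebesgue (f ` S) = \<bar>det (matrix f)\<bar> * measure lebesgue S"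
proof -
  define P where "P f \<longleftrightarrow> (\<forall>S\<in>lmeasurable. f ` S \<in> lmeasurable \<and>
      measure lebesgue (f ` S) = \<bar>det (matrix f)\<bar> * measure lebesgue S)" for f :: "real^'n \<Rightarrow> real^'n"
  have cbox: "P f" if "linear f" "\<bar>det (matrix f)\<bar> = 1"
    "\<And>a b. measure lebesgue (f ` cbox a b) = measure lebesgue (cbox a b)" for f
    unfolding P_def
  proof
    fix S :: "(real^'n) set" assume "S \<in> lmeasurable"
    then have "f ` S \<in> lmeasurable \<and> 1 * measure lebesgue S = measure lebesgue (f ` S)"
      by (rule measure_linear_sufficient[OF that(1)]) (simp only: that(3) mult_1)
    with that(2) show "f ` S \<in> lmeasurable \<and>
        measure lebesgue (f ` S) = \<bar>det (matrix f)\<bar> * measure lebesgue S"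
      by simp
  qed
  have "P f"
  proof (rule induct_linear_elementary[OF \<open>linear f\<close>])
    fix f g :: "real^'n \<Rightarrow> real^'n"
    assume "linear f" "linear g" "P f" "P g"
    then show "P (f \<circ> g)"
      by (auto simp: P_def image_comp [symmetric] matrix_compose det_mul abs_mult simp del: o_apply)
  next
    fix f :: "real^'n \<Rightarrow> real^'n" and i
    assume f: "linear f" "\<And>x. f x $ i = 0"
    then have "\<not> surj f"
      by (metis one_neq_zero surjE vec_component)
    then have "\<not> inj f"
      using linear_injective_imp_surjective f(1) by blast
    moreover from this have "det (matrix f) = 0"
      using det_nz_iff_inj f(1) by blast
    ultimately show "P f"
      using negligible_linear_singular_image[OF f(1)]
      by (auto simp: P_def negligible_imp_measure0 negligible_imp_measurable)
  next
    fix c :: "'n \<Rightarrow> real"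
    have "det (matrix (\<lambda>x. \<chi> i. c i * x $ i)) = prod c UNIV"
      by (subst det_diagonal) (auto simp: matrix_def axis_def)
    then show "P (\<lambda>x. \<chi> i. c i * x $ i)"
      by (simp add: P_def measurable_stretch measure_stretch)
  next
    fix m n :: 'n assume "m \<noteq> n"
    let ?h = "\<lambda>x::real^'n. \<chi> i. x $ Transposition.transpose m n i"
    have "matrix ?h = (\<chi> i. mat 1 $ Transposition.transpose m n i)"
      by (auto simp: matrix_def vec_eq_iff axis_def mat_def)
    then have "\<bar>det (matrix ?h)\<bar> = 1"
      by (simp add: det_permute_rows permutes_swap_id sign_swap_id abs_mult)
    moreover have "linear ?h"
      by (rule linearI) (auto simp: vec_eq_iff)
    ultimately show "P ?h"
      by (intro cbox measure_swap_cbox) (auto simp: permutes_swap_id)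
  next
    fix m n :: 'n assume "m \<noteq> n"
    moreover have "linear (\<lambda>x::real^'n. \<chi> i. if i = m then x$m + x$n else x$i)"
      by (rule linearI) (auto simp: vec_eq_iff algebra_simps)
    ultimately show "P (\<lambda>x. \<chi> i. if i = m then x$m + x$n else x$i)"
      by (intro cbox measure_shear_cbox) (auto simp: det_shear)
  qed
  then show "f ` S \<in> lmeasurable" "measure lebesgue (f ` S) = \<bar>det (matrix f)\<bar> * measure lebesgue S"
    using \<open>S \<in> lmeasurable\<close> by (auto simp: P_def)
qed

section \<open>The Brunn--Minkowski inequality\<close>

lemma set_plus_UN: "(S::'a::plus set) + T = (\<Union>x\<in>S. \<Union>y\<in>T. {x + y})"
  by (auto simp: set_plus_def)

lemma open_set_plus:
  fixes S T :: "'a::real_normed_vector set"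
  shows "open S \<Longrightarrow> open (S + T)"
  unfolding set_plus_UN by (rule open_sums) simp

lemma bounded_set_plus:
  fixes S T :: "'a::real_normed_vector set"
  shows "bounded S \<Longrightarrow> bounded T \<Longrightarrow> bounded (S + T)"
  unfolding set_plus_UN by (rule bounded_sums)

lemma compact_set_plus:
  fixes S T :: "'a::real_normed_vector set"
  shows "compact S \<Longrightarrow> compact T \<Longrightarrow> compact (S + T)"
  unfolding set_plus_UN by (rule compact_sums')

lemma vol_pos_open:
  fixes S :: "'a::euclidean_space set"
  assumes "open S" "bounded S" "S \<noteq> {}"
  shows "vol S > 0"
  using open_not_negligible[OF assms(1,3)] lmeasurable_open[OF assms(2,1)]
  by (simp add: negligible_iff_measure zero_less_measure_iff)

lemma vol_interior_convex:
  "convex S \<Longrightarrow> compact S \<Longrightarrow> vol (interior S) = vol S"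
  by (intro measure_interior compact_imp_bounded negligible_convex_frontier)

lemma vol_pos_convex:
  assumes "convex S" "compact S" "interior S \<noteq> {}"
  shows "vol S > 0"
  using assms vol_pos_open[of "interior S"] vol_interior_convex[of S]
  by (simp add: bounded_interior compact_imp_bounded)

text \<open>Brunn--Minkowski for boxes with side lengths \<open>p\<close> and \<open>q\<close>: divide by the right-hand side and apply the
  arithmetic-geometric mean inequality to the ratios \<open>p / (p + q)\<close> and \<open>q / (p + q)\<close>, which add up to 1.\<close>

lemma root_prod_add_le:
  fixes p q :: "'i \<Rightarrow> real"
  assumes S: "finite S" "S \<noteq> {}" and p: "\<And>i. i \<in> S \<Longrightarrow> p i > 0" and q: "\<And>i. i \<in> S \<Longrightarrow> q i > 0"
  shows "root (card S) (\<Prod>i\<in>S. p i) + root (card S) (\<Prod>i\<in>S. q i) \<le> root (card S) (\<Prod>i\<in>S. p i + q i)"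
proof -
  have n: "card S > 0" using S by (simp add: card_gt_0_iff)
  have root: "root (card S) (\<Prod>i\<in>S. r i) \<le> (\<Sum>i\<in>S. r i / card S)" if "\<And>i. i \<in> S \<Longrightarrow> r i > 0" for r :: "'i \<Rightarrow> real"
    using arith_geom_mean[OF S, of r] that n
    by (simp add: root_powr_inverse prod_pos less_imp_le)
  define g where "g i = p i + q i" for i
  have g: "g i > 0" if "i \<in> S" for i using p q that by (simp add: g_def add_pos_pos)
  have G: "root (card S) (prod g S) > 0" using n g by (simp add: prod_pos)
  have "root (card S) (\<Prod>i\<in>S. p i / g i) + root (card S) (\<Prod>i\<in>S. q i / g i)
      \<le> (\<Sum>i\<in>S. (p i / g i) / card S) + (\<Sum>i\<in>S. (q i / g i) / card S)"
    using p q g by (intro add_mono root) auto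
  also have "\<dots> = (\<Sum>i\<in>S. 1 / card S)"
    unfolding sum.distrib[symmetric]
    using g by (intro sum.cong) (auto simp: g_def simp flip: add_divide_distrib dest!: less_imp_neq[OF g])
  also have "\<dots> = 1" using n by simp
  finally show ?thesis
    using G by (simp add: prod_dividef real_root_divide field_simps) (simp add: g_def add.commute)
qed

text \<open>A point of the large box is split in each coordinate in the proportion in which it divides the side.\<close>

lemma box_plus_box_supset:
  fixes a b c d :: "'a::euclidean_space"
  assumes "box a b \<noteq> {}" "box c d \<noteq> {}"
  shows "box (a + c) (b + d) \<subseteq> box a b + box c d"
proof
  fix x assume x: "x \<in> box (a + c) (b + d)"
  have ab: "a \<bullet> i < b \<bullet> i" "c \<bullet> i < d \<bullet> i" if "i \<in> Basis" for i
    using assms that by (auto simp: box_ne_empty)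
  define t where "t i = (x \<bullet> i - a \<bullet> i - c \<bullet> i) / (b \<bullet> i - a \<bullet> i + (d \<bullet> i - c \<bullet> i))" for i
  define y where "y = (\<Sum>i\<in>Basis. (a \<bullet> i + t i * (b \<bullet> i - a \<bullet> i)) *\<^sub>R i)"
  have t: "0 < t i" "t i < 1" if "i \<in> Basis" for i
    using ab[OF that] x that by (auto simp: t_def mem_box inner_add_left field_simps)
  have y: "y \<in> box a b"
    using t ab by (auto simp: mem_box y_def intro!: mult_pos_pos) (smt (verit) mult_le_cancel_right1)
  have "(x - y) \<bullet> i = c \<bullet> i + t i * (d \<bullet> i - c \<bullet> i)" if "i \<in> Basis" for i
  proof -
    have "t i * (b \<bullet> i - a \<bullet> i + (d \<bullet> i - c \<bullet> i)) = x \<bullet> i - a \<bullet> i - c \<bullet> i"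
      using ab[OF that] by (simp add: t_def)
    moreover have "y \<bullet> i = a \<bullet> i + t i * (b \<bullet> i - a \<bullet> i)"
      using that by (simp add: y_def)
    ultimately show ?thesis by (simp add: inner_diff_left algebra_simps)
  qed
  then have "x - y \<in> box c d"
    using t ab by (auto simp: mem_box intro!: mult_pos_pos) (smt (verit) mult_le_cancel_right1)
  with y have "y + (x - y) \<in> box a b + box c d" by (intro set_plus_intro)
  then show "x \<in> box a b + box c d" by simp
qed

lemma vol_box:
  assumes "box a b \<noteq> {}"
  shows "vol (box a b :: 'a::euclidean_space set) = (\<Prod>i\<in>Basis. b \<bullet> i - a \<bullet> i)"
  using assms by (auto simp: measure_completion box_ne_empty measure_lborel_box_eq inner_diff_left less_imp_le)

text \<open>Finite unions of disjoint boxes carry the induction behind the Brunn--Minkowski inequality. The boxes are open, so that sums of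
  such unions are open and hence measurable.\<close>

definition box_family :: "'a::euclidean_space set set \<Rightarrow> bool" where
  "box_family F \<longleftrightarrow> finite F \<and> disjoint F \<and> (\<forall>P\<in>F. P \<noteq> {} \<and> (\<exists>a b. P = box a b))"

lemma box_familyD:
  assumes "box_family F"
  shows "open (\<Union>F)" "bounded (\<Union>F)" "\<Union>F \<in> lmeasurable"
proof -
  show o: "open (\<Union>F)"
    using assms by (auto simp: box_family_def intro!: open_Union dest!: bspec)
  show "bounded (\<Union>F)"
    using assms bounded_box by (auto simp: box_family_def intro!: bounded_Union)
  with o show "\<Union>F \<in> lmeasurable" by (simp add: lmeasurable_open)
qed

lemma box_Int_halfspace:
  fixes a b i :: "'a::euclidean_space"
  assumes "i \<in> Basis"
  shows "box a b \<inter> {x. x \<bullet> i < s} = box a (\<Sum>j\<in>Basis. (if j = i then min (b \<bullet> i) s else b \<bullet> j) *\<^sub>R j)"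
    and "box a b \<inter> {x. x \<bullet> i > s} = box (\<Sum>j\<in>Basis. (if j = i then max (a \<bullet> i) s else a \<bullet> j) *\<^sub>R j) b"
  using assms by (auto simp: mem_box split: if_splits)

text \<open>Halving a family along a coordinate hyperplane loses every box that lies on the other side; this makes the induction on
  the number of boxes work.\<close>

lemma box_family_cut:
  fixes F :: "'a::euclidean_space set set"
  assumes F: "box_family F" and H: "i \<in> Basis" "H = {x. x \<bullet> i < s} \<or> H = {x. x \<bullet> i > s}"
  defines "F' \<equiv> (\<lambda>P. P \<inter> H) ` F - {{}}"
  shows "box_family F'" "\<Union>F' = \<Union>F \<inter> H" "card F' \<le> card F"
    "\<exists>P\<in>F. P \<inter> H = {} \<Longrightarrow> card F' < card F"
proof -
  have fin: "finite F" using F by (simp add: box_family_def)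
  have "\<exists>a b. P \<inter> H = box a b" if "P \<in> F" for P
  proof -
    have "\<exists>a b. P = box a b" using F that by (simp add: box_family_def)
    then obtain a b where "P = box a b" by (elim exE)
    from H(2) show ?thesis
    proof
      assume "H = {x. x \<bullet> i < s}"
      then have "P \<inter> H = box a (\<Sum>j\<in>Basis. (if j = i then min (b \<bullet> i) s else b \<bullet> j) *\<^sub>R j)"
        using box_Int_halfspace(1)[OF H(1)] \<open>P = box a b\<close> by simp
      then show ?thesis by (intro exI)
    next
      assume "H = {x. x \<bullet> i > s}"
      then have "P \<inter> H = box (\<Sum>j\<in>Basis. (if j = i then max (a \<bullet> i) s else a \<bullet> j) *\<^sub>R j) b"
        using box_Int_halfspace(2)[OF H(1)] \<open>P = box a b\<close> by simp
      then show ?thesis by (intro exI)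
    qed
  qed
  moreover have "disjoint F'"
    using F unfolding box_family_def F'_def pairwise_def disjnt_def by blast
  ultimately show "box_family F'"
    using fin unfolding box_family_def F'_def by auto
  show "\<Union>F' = \<Union>F \<inter> H" by (auto simp: F'_def)
  show "card F' \<le> card F"
    unfolding F'_def using fin by (meson card_Diff1_le card_image_le card_mono finite_imageI Diff_subset le_trans)
  assume "\<exists>P\<in>F. P \<inter> H = {}"
  then obtain P where P: "P \<in> F" "P \<inter> H = {}" by blast
  then have "F' \<subseteq> (\<lambda>P. P \<inter> H) ` (F - {P})" by (auto simp: F'_def)
  then have "card F' \<le> card (F - {P})"
    by (meson card_image_le card_mono fin finite_Diff finite_imageI le_trans)
  also have "\<dots> < card F" using P fin by (metis card_Diff1_less)
  finally show "card F' < card F" .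
qed

lemma vol_Un_disjoint:
  "S \<in> lmeasurable \<Longrightarrow> T \<in> lmeasurable \<Longrightarrow> S \<inter> T = {} \<Longrightarrow> vol (S \<union> T) = vol S + vol T"
  by (simp add: measure_Un3)

lemma vol_split_halfspace:
  fixes U :: "'a::euclidean_space set"
  assumes "open U" "bounded U" "i \<in> Basis"
  shows "vol U = vol (U \<inter> {x. x \<bullet> i < s}) + vol (U \<inter> {x. x \<bullet> i > s})"
proof -
  have o: "open (U \<inter> {x. x \<bullet> i < s})" "open (U \<inter> {x. x \<bullet> i > s})"
    by (auto intro!: open_Int assms(1) open_halfspace_component_lt open_halfspace_component_gt)
  have "negligible {x. x \<bullet> i = s}"
    using negligible_standard_hyperplane[OF assms(3)] .
  then have "vol U = vol ((U \<inter> {x. x \<bullet> i < s}) \<union> (U \<inter> {x. x \<bullet> i > s}))"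
    by (intro measure_negligible_symdiff) (auto intro: negligible_subset lmeasurable_open assms o)
  also have "\<dots> = vol (U \<inter> {x. x \<bullet> i < s}) + vol (U \<inter> {x. x \<bullet> i > s})"
    by (intro vol_Un_disjoint) (auto intro!: lmeasurable_open o bounded_Int assms)
  finally show ?thesis .
qed

text \<open>The volume below the level \<open>s\<close> is a Lipschitz function of \<open>s\<close>, because the part of a bounded set between two
  levels lies in a thin box; hence it takes all intermediate values.\<close>

lemma vol_halfspace_intermediate:
  fixes U :: "'a::euclidean_space set"
  assumes U: "open U" "bounded U" and i: "i \<in> Basis" and v: "0 \<le> v" "v \<le> vol U"
  obtains s where "vol (U \<inter> {x. x \<bullet> i < s}) = v"
proof -
  obtain r where r: "r > 0" and "U \<subseteq> ball 0 r"
    using U(2) by (meson bounded_subset_ballD)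
  then have Ur: "\<bar>x \<bullet> j\<bar> < r" if "x \<in> U" "j \<in> Basis" for x j
    using that Basis_le_norm[of j x] by fastforce
  define H where "H s = {x. x \<bullet> i < s}" for s
  have meas: "U \<inter> H s \<in> lmeasurable" for s
    unfolding H_def using U open_halfspace_component_lt by (intro lmeasurable_open) (auto intro: bounded_Int)
  have "((2 * r) ^ (DIM('a) - 1))-lipschitz_on UNIV (\<lambda>s. vol (U \<inter> H s))"
  proof (rule lipschitz_on_leI)
    fix s t :: real assume "s \<le> t"
    define l where "l = (\<Sum>j\<in>Basis. (if j = i then s else - r) *\<^sub>R j)"
    define m where "m = (\<Sum>j\<in>Basis. (if j = i then t else r) *\<^sub>R j)"
    have "vol (cbox l m) = (\<Prod>j\<in>Basis. if j = i then t - s else 2 * r)"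
      using r \<open>s \<le> t\<close> by (auto simp: measure_completion content_cbox_cases l_def m_def intro!: prod.cong)
    also have "\<dots> = (2 * r) ^ (DIM('a) - 1) * (t - s)"
      using i by (subst prod.remove[OF _ i]) (auto simp: card_Diff_singleton)
    finally have V: "vol (cbox l m) = (2 * r) ^ (DIM('a) - 1) * (t - s)" .
    have "vol (U \<inter> H t) \<le> vol ((U \<inter> H s) \<union> cbox l m)"
    proof (intro measure_mono_fmeasurable)
      show "U \<inter> H t \<subseteq> (U \<inter> H s) \<union> cbox l m"
        using Ur i by (auto simp: H_def mem_box l_def m_def not_less) (smt (verit))+
    qed (use meas in \<open>auto intro: fmeasurableD fmeasurable.Un\<close>)
    also have "\<dots> \<le> vol (U \<inter> H s) + vol (cbox l m)"
      by (intro measure_Un_le) (use meas in \<open>auto intro: fmeasurableD\<close>)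
    finally have 1: "vol (U \<inter> H t) \<le> vol (U \<inter> H s) + (2 * r) ^ (DIM('a) - 1) * (t - s)"
      by (simp only: V)
    have "vol (U \<inter> H s) \<le> vol (U \<inter> H t)"
      using \<open>s \<le> t\<close> meas by (intro measure_mono_fmeasurable) (auto simp: H_def intro: fmeasurableD)
    with 1 show "dist (vol (U \<inter> H s)) (vol (U \<inter> H t)) \<le> (2 * r) ^ (DIM('a) - 1) * dist s t"
      using \<open>s \<le> t\<close> by (simp add: dist_real_def)
  qed (use r in auto)
  then have cont: "continuous_on {-r..r} (\<lambda>s. vol (U \<inter> H s))"
    by (meson lipschitz_on_continuous_on continuous_on_subset subset_UNIV)
  have "U \<inter> H (-r) = {}" "U \<inter> H r = U"
    using Ur[OF _ i] by (fastforce simp: H_def abs_less_iff)+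
  then have "\<exists>s\<ge>-r. s \<le> r \<and> vol (U \<inter> H s) = v"
    using v r by (intro IVT' cont) auto
  then show ?thesis using that by (auto simp: H_def)
qed

text \<open>The argument of Hadwiger and Ohmann. If one of the families, say \<open>F\<close>, has two boxes, some hyperplane \<open>x \<bullet> i = s\<close> separates them, so each
  half of \<open>F\<close> has fewer boxes. A parallel hyperplane cuts \<open>G\<close> in the same ratio of volumes. The sums of the corresponding
  halves lie on different sides of \<open>x \<bullet> i = s + s'\<close>, so their volumes add up, and because the ratios agree the two
  bounds from the induction hypothesis add up to the bound for the whole.\<close>

lemma brunn_minkowski_boxes:
  fixes F G :: "'a::euclidean_space set set"
  assumes "box_family F" "box_family G" "F \<noteq> {}" "G \<noteq> {}"
  shows "root DIM('a) (vol (\<Union>F)) + root DIM('a) (vol (\<Union>G)) \<le> root DIM('a) (vol (\<Union>F + \<Union>G))"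
  using assms
proof (induction "card F + card G" arbitrary: F G rule: less_induct)
  case less
  let ?n = "DIM('a)"
  let ?r = "root DIM('a)"
  have pos: "vol (\<Union>F) > 0" if "box_family F" "F \<noteq> {}" for F :: "'a set set"
    using box_familyD[OF that(1)] that by (intro vol_pos_open) (auto simp: box_family_def)
  have step: "?r (vol (\<Union>F)) + ?r (vol (\<Union>G)) \<le> ?r (vol (\<Union>F + \<Union>G))"
    if IH: "\<And>F' G' :: 'a set set. card F' + card G' < card F + card G \<Longrightarrow> box_family F' \<Longrightarrow> box_family G' \<Longrightarrow>
        F' \<noteq> {} \<Longrightarrow> G' \<noteq> {} \<Longrightarrow> ?r (vol (\<Union>F')) + ?r (vol (\<Union>G')) \<le> ?r (vol (\<Union>F' + \<Union>G'))"
      and F: "box_family F" and G: "box_family G" "G \<noteq> {}" and card: "card F \<ge> 2"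
    for F G :: "'a set set"
  proof -
    obtain P Q where PQ: "P \<in> F" "Q \<in> F" "P \<noteq> Q"
      using card by (metis card_le_Suc0_iff_eq F box_family_def not_less_eq_eq numeral_2_eq_2)
    obtain a b c d where ab: "P = box a b" "Q = box c d" and ne: "box a b \<noteq> {}" "box c d \<noteq> {}"
      using F PQ unfolding box_family_def by metis
    have "box a b \<inter> box c d = {}"
      using F PQ ab unfolding box_family_def pairwise_def disjnt_def by auto
    then obtain i where i: "i \<in> Basis" "b \<bullet> i \<le> c \<bullet> i \<or> d \<bullet> i \<le> a \<bullet> i"
      using ne unfolding Int_interval disjoint_interval(4) box_ne_empty
      by (metis not_le)
    have "\<exists>P\<in>F. \<exists>Q\<in>F. \<exists>s. P \<noteq> {} \<and> Q \<noteq> {} \<and> P \<subseteq> {x. x \<bullet> i < s} \<and> Q \<subseteq> {x. x \<bullet> i > s}"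
      using i(2)
    proof
      assume "b \<bullet> i \<le> c \<bullet> i"
      then have "P \<subseteq> {x. x \<bullet> i < b \<bullet> i}" "Q \<subseteq> {x. x \<bullet> i > b \<bullet> i}"
        using i(1) unfolding ab by (fastforce simp: mem_box)+
      then show ?thesis using PQ ab ne by blast
    next
      assume "d \<bullet> i \<le> a \<bullet> i"
      then have "Q \<subseteq> {x. x \<bullet> i < d \<bullet> i}" "P \<subseteq> {x. x \<bullet> i > d \<bullet> i}"
        using i(1) unfolding ab by (fastforce simp: mem_box)+
      then show ?thesis using PQ ab ne by blast
    qed
    then obtain P Q s where P: "P \<in> F" "P \<noteq> {}" "P \<subseteq> {x. x \<bullet> i < s}"
      and Q: "Q \<in> F" "Q \<noteq> {}" "Q \<subseteq> {x. x \<bullet> i > s}" by blast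
    define U W where "U = \<Union>F" and "W = \<Union>G"
    have U: "open U" "bounded U" and W: "open W" "bounded W"
      using box_familyD F G by (auto simp: U_def W_def)
    define lo hi where "lo t = {x. x \<bullet> i < t}" and "hi t = {x. x \<bullet> i > t}" for t
    have oh: "open (lo t)" "open (hi t)" for t
      unfolding lo_def hi_def by (rule open_halfspace_component_lt open_halfspace_component_gt)+
    define u1 u2 u w where "u1 = vol (U \<inter> lo s)" and "u2 = vol (U \<inter> hi s)" and "u = vol U" and "w = vol W"
    have "U \<inter> lo s \<noteq> {}" "U \<inter> hi s \<noteq> {}"
      using P Q by (auto simp: U_def lo_def hi_def)
    then have u12: "u1 > 0" "u2 > 0"
      unfolding u1_def u2_def using U oh by (auto intro!: vol_pos_open)
    have u: "u = u1 + u2"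
      unfolding u1_def u2_def u_def lo_def hi_def using vol_split_halfspace U i(1) by blast
    have w: "w > 0" using pos[OF G] by (simp add: w_def W_def)
    \<comment> \<open>k is the ratio of the two volumes; the pieces of W are chosen k times as large as those of U.\<close>
    define k where "k = w / u"
    have "w = k * u" using u u12 by (simp add: k_def)
    then have "w = k * u1 + k * u2" by (simp add: u distrib_left)
    moreover have "k > 0" using w u u12 by (simp add: k_def)
    ultimately have k: "k > 0" "w = k * u1 + k * u2" by blast+
    obtain s' where s': "vol (W \<inter> lo s') = k * u1"
      unfolding lo_def
      by (rule vol_halfspace_intermediate[OF W i(1), of "k * u1"]) (use k u12 w_def in auto)
    have s'': "vol (W \<inter> hi s') = k * u2"
      using vol_split_halfspace[OF W i(1), of s'] s' k by (simp add: w_def lo_def hi_def)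
    define part where "part H E = (\<lambda>P. P \<inter> H) ` E - {{}}" for H :: "'a set" and E
    note cut = box_family_cut[OF _ i(1), folded part_def]
    have H: "lo t = {x. x \<bullet> i < t} \<or> lo t = {x. x \<bullet> i > t}" "hi t = {x. x \<bullet> i < t} \<or> hi t = {x. x \<bullet> i > t}" for t
      by (auto simp: lo_def hi_def)
    have piece: "(?r v + ?r (k * v)) ^ ?n \<le> vol (U \<inter> H + W \<inter> H')"
      if v: "v > 0" "vol (U \<inter> H) = v" "vol (W \<inter> H') = k * v" and R: "\<exists>R\<in>F. R \<inter> H = {}"
        and H: "H = {x. x \<bullet> i < t} \<or> H = {x. x \<bullet> i > t}"  "H' = {x. x \<bullet> i < t'} \<or> H' = {x. x \<bullet> i > t'}"
      for v H H' t t'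
    proof -
      have ne: "part H F \<noteq> {}" "part H' G \<noteq> {}"
        using v k(1) cut(2)[OF F H(1)] cut(2)[OF G(1) H(2)] by (auto simp: U_def W_def)
      have "?r (vol (\<Union>(part H F))) + ?r (vol (\<Union>(part H' G))) \<le> ?r (vol (\<Union>(part H F) + \<Union>(part H' G)))"
        using cut(4)[OF F H(1) R] cut(3)[OF G(1) H(2)] ne
        by (intro IH cut(1)[OF F H(1)] cut(1)[OF G(1) H(2)]) auto
      then have "?r v + ?r (k * v) \<le> ?r (vol (U \<inter> H + W \<inter> H'))"
        using v by (simp add: cut(2)[OF F H(1)] cut(2)[OF G(1) H(2)] U_def W_def)
      then have "(?r v + ?r (k * v)) ^ ?n \<le> (?r (vol (U \<inter> H + W \<inter> H'))) ^ ?n"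
        using v k(1) by (intro power_mono) auto
      then show ?thesis by simp
    qed
    \<comment> \<open>With a common ratio k the lower bound is linear in the volume of the piece, so it is additive.\<close>
    have eq: "(?r v + ?r (k * v)) ^ ?n = v * (1 + ?r k) ^ ?n" if "v > 0" for v
    proof -
      have "?r v + ?r (k * v) = ?r v * (1 + ?r k)" by (simp add: real_root_mult algebra_simps)
      then show ?thesis using that by (simp add: power_mult_distrib)
    qed
    have "u * (1 + ?r k) ^ ?n = (?r u1 + ?r (k * u1)) ^ ?n + (?r u2 + ?r (k * u2)) ^ ?n"
      by (simp only: eq u12 u distrib_right)
    also have "\<dots> \<le> vol (U \<inter> lo s + W \<inter> lo s') + vol (U \<inter> hi s + W \<inter> hi s')"
    proof (intro add_mono piece[where t = s and t' = s'])
      show "\<exists>R\<in>F. R \<inter> lo s = {}"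
        using Q(1,3) by (intro bexI[of _ Q]) (auto simp: lo_def)
      show "\<exists>R\<in>F. R \<inter> hi s = {}"
        using P(1,3) by (intro bexI[of _ P]) (auto simp: hi_def)
    qed (use u12 u1_def u2_def s' s'' H in \<open>simp_all only:\<close>)
    also have "\<dots> = vol ((U \<inter> lo s + W \<inter> lo s') \<union> (U \<inter> hi s + W \<inter> hi s'))"
    proof (intro vol_Un_disjoint[symmetric])
      show "(U \<inter> lo s + W \<inter> lo s') \<inter> (U \<inter> hi s + W \<inter> hi s') = {}"
      proof -
        have "U \<inter> lo s + W \<inter> lo s' \<subseteq> lo (s + s')" "U \<inter> hi s + W \<inter> hi s' \<subseteq> hi (s + s')"
          by (auto simp: set_plus_def lo_def hi_def inner_add_left)
        moreover have "lo (s + s') \<inter> hi (s + s') = {}" by (auto simp: lo_def hi_def)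
        ultimately show ?thesis by blast
      qed
    qed (auto intro!: lmeasurable_open bounded_set_plus open_set_plus bounded_Int U W oh)
    also have "\<dots> \<le> vol (U + W)"
      by (intro measure_mono_fmeasurable)
        (auto intro!: lmeasurable_open bounded_set_plus open_set_plus U W oh fmeasurableD fmeasurable.Un bounded_Int,
          auto simp: set_plus_def)
    finally have "?r (u * (1 + ?r k) ^ ?n) \<le> ?r (vol (U + W))" by simp
    moreover have "?r (u * (1 + ?r k) ^ ?n) = ?r u + ?r w"
    proof -
      have "w = k * u" by (simp add: k(2) u algebra_simps)
      moreover have "?r ((1 + ?r k) ^ ?n) = 1 + ?r k"
        using k(1) by (intro real_root_power_cancel) auto
      ultimately show ?thesis by (simp add: real_root_mult algebra_simps)
    qed
    ultimately show ?thesis unfolding u_def w_def U_def W_def by linarith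
  qed
  have fin: "finite F" "finite G" using less.prems by (auto simp: box_family_def)
  consider "card F \<ge> 2" | "card G \<ge> 2" | "card F = 1" "card G = 1"
    using fin less.prems(3,4) by (metis One_nat_def Suc_leI card_gt_0_iff le_antisym not_less_eq_eq numeral_2_eq_2)
  then show ?case
  proof cases
    case 1
    show ?thesis by (rule step[OF _ less.prems(1,2,4) 1]) (rule less.hyps)
  next
    case 2
    have "?r (vol (\<Union>G)) + ?r (vol (\<Union>F)) \<le> ?r (vol (\<Union>G + \<Union>F))"
      by (rule step[OF _ less.prems(2,1,3) 2]) (rule less.hyps, auto)
    then show ?thesis by (simp add: add.commute)
  next
    case 3
    then obtain P Q where PQ: "F = {P}" "G = {Q}" by (meson card_1_singletonE)
    then obtain a b c d where ab: "P = box a b" "Q = box c d" and ne: "box a b \<noteq> {}" "box c d \<noteq> {}"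
      using less.prems(1,2) unfolding box_family_def by (metis insertI1)
    have ne': "box (a + c) (b + d) \<noteq> {}"
      using ne by (auto simp: box_ne_empty inner_add_left intro: add_strict_mono)
    have "?r (vol P) + ?r (vol Q) \<le> ?r (\<Prod>i\<in>Basis. (b \<bullet> i - a \<bullet> i) + (d \<bullet> i - c \<bullet> i))"
      unfolding ab vol_box[OF ne(1)] vol_box[OF ne(2)]
      using ne by (intro root_prod_add_le) (auto simp: box_ne_empty)
    also have "(\<Prod>i\<in>Basis. (b \<bullet> i - a \<bullet> i) + (d \<bullet> i - c \<bullet> i)) = vol (box (a + c) (b + d))"
      unfolding vol_box[OF ne'] by (simp add: inner_add_left algebra_simps)
    also have "?r \<dots> \<le> ?r (vol (P + Q))"
      using box_plus_box_supset[OF ne] unfolding ab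
      by (simp, intro measure_mono_fmeasurable)
        (auto intro!: lmeasurable_open bounded_set_plus open_set_plus)
    finally show ?thesis by (simp add: PQ)
  qed
qed

text \<open>The gauge in \<open>covering_lemma\<close> is chosen such that all boxes of the covering stay inside the open set.\<close>

lemma open_inner_box_family:
  fixes A :: "'a::euclidean_space set"
  assumes A: "open A" "bounded A" and v: "0 \<le> v" "v < vol A"
  obtains F where "box_family F" "F \<noteq> {}" "\<Union>F \<subseteq> A" "v < vol (\<Union>F)"
proof -
  obtain a b :: 'a where ab: "A \<subseteq> cbox a b" "box a b \<noteq> {}"
    by (metis bounded_subset_cbox_symmetric A(2) bounded_subset_box_symmetric box_subset_cbox v measure_empty order.trans subset_empty less_le_not_le)
  define g where "g x = (if x \<in> A then A else UNIV)" for x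
  have "gauge g" using A(1) by (auto simp: gauge_def g_def)
  from covering_lemma[OF ab this] obtain D where D: "countable D"
    "\<And>K. K \<in> D \<Longrightarrow> interior K \<noteq> {} \<and> (\<exists>c d. K = cbox c d)"
    "pairwise (\<lambda>A B. interior A \<inter> interior B = {}) D"
    "\<And>K. K \<in> D \<Longrightarrow> \<exists>x \<in> A \<inter> K. K \<subseteq> g x" "A \<subseteq> \<Union>D" by metis
  have KA: "K \<subseteq> A" if "K \<in> D" for K using D(4)[OF that] by (auto simp: g_def)
  define E where "E = interior ` D"
  have "A - \<Union>E \<subseteq> (\<Union>K\<in>D. frontier K)"
  proof
    fix x assume x: "x \<in> A - \<Union>E"
    then obtain K where "K \<in> D" "x \<in> K" using D(5) by blast
    then show "x \<in> (\<Union>K\<in>D. frontier K)"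
      using x closure_subset by (auto simp: E_def frontier_def)
  qed
  moreover have "negligible (\<Union>K\<in>D. frontier K)"
    using D(1,2) by (intro negligible_countable_Union) (auto intro!: negligible_convex_frontier dest!: D(2))
  ultimately have neg: "negligible (A - \<Union>E)" by (metis negligible_subset)
  have EA: "\<Union>E \<subseteq> A" using KA interior_subset by (fastforce simp: E_def)
  have oE: "open (\<Union>E)" by (auto simp: E_def)
  have "vol (\<Union>E) = vol A"
    using neg EA by (intro measure_negligible_symdiff lmeasurable_open)
      (auto intro: A oE bounded_subset[OF A(2)] simp: Diff_eq_empty_iff)
  moreover obtain E' where E': "E' \<subseteq> E" "finite E'" "vol (\<Union>E) - (vol A - v) < vol (\<Union>E')"
  proof (rule measure_countable_Union_approachable[of E "vol A - v" "vol A"])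
    show "countable E" using D(1) by (simp add: E_def)
    show "d \<in> lmeasurable" if "d \<in> E" for d
      using that EA A(2) by (auto simp: E_def intro!: lmeasurable_open intro: bounded_subset)
    show "vol (\<Union>D') \<le> vol A" if "D' \<subseteq> E" for D'
    proof (intro measure_mono_fmeasurable)
      have "open S" if "S \<in> D'" for S using that \<open>D' \<subseteq> E\<close> by (auto simp: E_def)
      then show "\<Union>D' \<in> sets lebesgue" by (intro sets_completionI_sets) (simp add: open_Union)
    qed (use that EA A in \<open>auto intro!: lmeasurable_open\<close>)
  qed (use v in auto)
  ultimately have vE': "v < vol (\<Union>E')" by simp
  moreover have "box_family E'"
    unfolding box_family_def
  proof (intro conjI ballI)
    show "finite E'" by fact
    show "disjoint E'"
    proof (rule pairwiseI)
      fix P Q assume "P \<in> E'" "Q \<in> E'" "P \<noteq> Q"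
      moreover from this obtain K L where "K \<in> D" "P = interior K" "L \<in> D" "Q = interior L"
        using subsetD[OF E'(1)] unfolding E_def image_iff by metis
      ultimately show "disjnt P Q"
        using pairwiseD[OF D(3), of K L] by (auto simp: disjnt_def)
    qed
    show "P \<noteq> {}" "\<exists>a b. P = box a b" if "P \<in> E'" for P
    proof -
      obtain K where K: "K \<in> D" "P = interior K" using \<open>P \<in> E'\<close> E'(1) by (auto simp: E_def)
      from D(2)[OF K(1)] show "P \<noteq> {}" "\<exists>a b. P = box a b" by (auto simp: K(2) interior_cbox) blast
    qed
  qed
  moreover have "E' \<noteq> {}" using vE' v by auto
  ultimately show ?thesis using that E'(1) EA by blast
qed

theorem brunn_minkowski_open:
  fixes A B :: "'a::euclidean_space set"
  assumes A: "open A" "bounded A" "A \<noteq> {}" and B: "open B" "bounded B" "B \<noteq> {}"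
  shows "root DIM('a) (vol A) + root DIM('a) (vol B) \<le> root DIM('a) (vol (A + B))"
proof -
  let ?r = "root DIM('a)"
  have pos: "vol A > 0" "vol B > 0" using A B vol_pos_open by auto
  have le: "?r v + ?r w \<le> ?r (vol (A + B))" if v: "0 \<le> v" "v < vol A" and w: "0 \<le> w" "w < vol B" for v w
  proof -
    obtain F where F: "box_family F" "F \<noteq> {}" "\<Union>F \<subseteq> A" "v < vol (\<Union>F)"
      using open_inner_box_family[OF A(1,2) v] .
    obtain G where G: "box_family G" "G \<noteq> {}" "\<Union>G \<subseteq> B" "w < vol (\<Union>G)"
      using open_inner_box_family[OF B(1,2) w] .
    have "?r v + ?r w \<le> ?r (vol (\<Union>F)) + ?r (vol (\<Union>G))"
      using F(4) G(4) by (intro add_mono) auto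
    also have "\<dots> \<le> ?r (vol (\<Union>F + \<Union>G))"
      by (rule brunn_minkowski_boxes) fact+
    also have "\<dots> \<le> ?r (vol (A + B))"
      using F(3) G(3) box_familyD[OF F(1)] A B
      by (simp, intro measure_mono_fmeasurable set_plus_mono2)
        (auto intro!: lmeasurable_open bounded_set_plus open_set_plus borel_open sets_completionI_sets)
    finally show ?thesis .
  qed
  show ?thesis
  proof (rule tendsto_upperbound)
    show "((\<lambda>t. ?r (t * vol A) + ?r (t * vol B)) \<longlongrightarrow> ?r (vol A) + ?r (vol B)) (at_left 1)"
      by (auto intro!: tendsto_eq_intros)
    show "\<forall>\<^sub>F t in at_left 1. ?r (t * vol A) + ?r (t * vol B) \<le> ?r (vol (A + B))"
      using eventually_at_left_real[of 0 1, simplified] by eventually_elim (use pos in \<open>auto intro!: le\<close>)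
  qed simp
qed

text \<open>The boundary of a convex set has volume 0, so the interiors can be used.\<close>

theorem brunn_minkowski_convex:
  fixes A B :: "'a::euclidean_space set"
  assumes A: "convex A" "compact A" "interior A \<noteq> {}" and B: "convex B" "compact B" "interior B \<noteq> {}"
  shows "root DIM('a) (vol A) + root DIM('a) (vol B) \<le> root DIM('a) (vol (A + B))"
proof -
  have "root DIM('a) (vol A) + root DIM('a) (vol B) \<le> root DIM('a) (vol (interior A + interior B))"
    using brunn_minkowski_open[of "interior A" "interior B"] A B
    by (simp add: bounded_interior compact_imp_bounded vol_interior_convex)
  also have "\<dots> \<le> root DIM('a) (vol (A + B))"
    using A B by (simp, intro measure_mono_fmeasurable set_plus_mono2 interior_subset)
      (auto intro!: lmeasurable_compact compact_set_plus borel_open sets_completionI_sets open_set_plus)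
  finally show ?thesis .
qed

section \<open>Slices along a line\<close>

text \<open>It is enough to compare the two measures on boxes, where linear images scale volume by the determinant.\<close>

lemma distr_lborel_orthogonal:
  fixes L :: "real^'n \<Rightarrow> real^'n"
  assumes L: "orthogonal_transformation L"
  shows "distr lborel borel L = lborel"
proof (rule lborel_eqI[symmetric])
  fix l u :: "real^'n" assume lu: "\<And>b. b \<in> Basis \<Longrightarrow> l \<bullet> b \<le> u \<bullet> b"
  have lin: "linear L" using L by (rule orthogonal_transformation_linear)
  have cont: "continuous_on UNIV L" using lin by (simp add: linear_continuous_on linear_linear)
  then have [measurable]: "L \<in> borel \<rightarrow>\<^sub>M borel" by (rule borel_measurable_continuous_onI)
  have surj: "surj L"
    using L by (rule orthogonal_transformation_surj)
  let ?S = "L -` box l u"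
  have im: "L ` ?S = box l u" using surj by (simp add: surj_image_vimage_eq)
  have "open ?S" using cont open_box by (rule open_vimage[rotated])
  moreover have "bounded ?S"
  proof -
    obtain e where "\<And>x. x \<in> box l u \<Longrightarrow> norm x \<le> e" using bounded_box unfolding bounded_iff by blast
    then have "norm x \<le> e" if "x \<in> L -` box l u" for x
      using that orthogonal_transformation_norm[OF L, of x] by (metis vimageE)
    then show ?thesis by (rule boundedI)
  qed
  ultimately have S: "?S \<in> lmeasurable" by (rule lmeasurable_open[rotated])
  have "vol (box l u) = \<bar>det (matrix L)\<bar> * vol ?S"
    using measure_linear_image_det(2)[OF lin S] by (simp only: im)
  also have "\<bar>det (matrix L)\<bar> = 1"
    using L by (metis det_orthogonal_matrix orthogonal_transformation_matrix abs_1 abs_minus_cancel)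
  finally have "vol ?S = vol (box l u)" by simp
  then have "measure lborel ?S = measure lborel (box l u)"
    using \<open>open ?S\<close> by (simp add: measure_completion)
  moreover have "emeasure lborel ?S \<noteq> \<infinity>" 
    using \<open>bounded ?S\<close> emeasure_bounded_finite by (metis infinity_ennreal_def less_irrefl)
  moreover have "emeasure lborel (box l u) \<noteq> \<infinity>"
    using bounded_box emeasure_bounded_finite by (metis infinity_ennreal_def less_irrefl)
  ultimately have "emeasure lborel ?S = emeasure lborel (box l u)"
    by (simp add: emeasure_eq_ennreal_measure)
  then show "emeasure (distr lborel borel L) (box l u) = (\<Prod>b\<in>Basis. (u - l) \<bullet> b)"
    using lu by (simp add: emeasure_distr emeasure_lborel_box)
qed simp

text \<open>Lebesgue measure is defined as the product measure in the coordinates of the standard basis. A rotation \<open>L\<close> that sends the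
  standard basis to \<open>B\<close> transports this description to the coordinates with respect to \<open>B\<close>.\<close>

lemma lborel_eq_distr_orthonormal:
  fixes B :: "(real^'n) set"
  assumes B: "pairwise orthogonal B" "\<And>b. b \<in> B \<Longrightarrow> norm b = 1" "span B = UNIV"
  shows "lborel = distr (\<Pi>\<^sub>M b\<in>B. lborel) borel (\<lambda>f. \<Sum>b\<in>B. f b *\<^sub>R b)"
proof -
  have "0 \<notin> B" using B(2) by force
  then have ind: "independent B" using B(1) pairwise_orthogonal_independent by blast
  then have fin: "finite B" by (rule independent_imp_finite)
  have "card B = card (Basis :: (real^'n) set)"
    using dim_eq_card[of B UNIV] ind B(3) by (simp add: dim_UNIV del: DIM_cart)
  then obtain \<tau> where \<tau>: "bij_betw \<tau> B (Basis :: (real^'n) set)"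
    using finite_same_card_bij[OF fin finite_Basis] by metis
  define \<sigma> where "\<sigma> = the_inv_into B \<tau>"
  have \<sigma>: "\<sigma> (\<tau> b) = b" if "b \<in> B" for b
    using \<tau> that by (simp add: \<sigma>_def bij_betw_def the_inv_into_f_f)
  have \<tau>B: "\<tau> b \<in> Basis" if "b \<in> B" for b using \<tau> that by (auto simp: bij_betw_def)
  \<comment> \<open>\<tau> matches B with the standard basis, and L maps each \<tau> b to b.\<close>
  define L where "L x = (\<Sum>b\<in>B. (x \<bullet> \<tau> b) *\<^sub>R b)" for x
  have lin: "linear L"
    by (rule linearI) (auto simp: L_def inner_add_left scaleR_add_left sum.distrib scaleR_sum_right)
  have "norm (L x) = norm x" for x
  proof -
    have "(norm (L x))\<^sup>2 = (\<Sum>b\<in>B. (norm ((x \<bullet> \<tau> b) *\<^sub>R b))\<^sup>2)"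
      unfolding L_def using B(1)
      by (intro norm_sum_Pythagorean fin) (auto simp: pairwise_def orthogonal_def)
    also have "\<dots> = (\<Sum>b\<in>B. (x \<bullet> \<tau> b)\<^sup>2)"
      using B(2) by (intro sum.cong) (auto simp: power_mult_distrib)
    also have "\<dots> = (\<Sum>j\<in>Basis. (x \<bullet> j)\<^sup>2)"
      by (rule sum.reindex_bij_betw[OF \<tau>, of "\<lambda>j. (x \<bullet> j)\<^sup>2"])
    also have "\<dots> = x \<bullet> x"
      by (subst euclidean_inner) (simp add: power2_eq_square)
    also have "\<dots> = (norm x)\<^sup>2" by (rule dot_square_norm)
    finally show ?thesis by simp
  qed
  then have L: "orthogonal_transformation L" using lin by (simp add: orthogonal_transformation)
  have [measurable]: "L \<in> borel \<rightarrow>\<^sub>M borel"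
    by (intro borel_measurable_continuous_onI linear_continuous_on) (use lin in \<open>simp add: linear_linear\<close>)
  interpret P: product_sigma_finite "\<lambda>_::real^'n. lborel :: real measure" by standard
  interpret F: finite_product_sigma_finite "\<lambda>_::real^'n. lborel :: real measure" B by standard fact
  define M :: "(real^'n) measure" where "M = distr (\<Pi>\<^sub>M b\<in>B. lborel) borel (\<lambda>f. \<Sum>b\<in>B. f b *\<^sub>R \<tau> b)"
  have coord: "(\<Sum>b\<in>B. f b *\<^sub>R \<tau> b) \<bullet> \<tau> c = f c" if "c \<in> B" for f c
  proof -
    have "(\<Sum>b\<in>B. f b *\<^sub>R \<tau> b) \<bullet> \<tau> c = (\<Sum>b\<in>B. if b = c then f b else 0)"
      unfolding inner_sum_left using \<tau> that \<tau>B
      by (intro sum.cong) (auto simp: inner_Basis bij_betw_def dest: inj_onD)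
    then show ?thesis using that fin by simp
  qed
  have "lborel = M"
  proof (rule lborel_eqI)
    fix l u :: "real^'n" assume lu: "\<And>b. b \<in> Basis \<Longrightarrow> l \<bullet> b \<le> u \<bullet> b"
    have all: "(\<forall>j\<in>Basis. Q j) \<longleftrightarrow> (\<forall>b\<in>B. Q (\<tau> b))" for Q
      using \<tau> unfolding bij_betw_def by (metis imageE image_eqI)
    have "(\<lambda>f. \<Sum>b\<in>B. f b *\<^sub>R \<tau> b) -` box l u \<inter> space (\<Pi>\<^sub>M b\<in>B. lborel)
        = (\<Pi>\<^sub>E b\<in>B. {l \<bullet> \<tau> b<..<u \<bullet> \<tau> b})"
      by (auto simp: mem_box all coord space_PiM PiE_def Pi_def)
    then have "emeasure M (box l u) = emeasure (\<Pi>\<^sub>M b\<in>B. lborel) (\<Pi>\<^sub>E b\<in>B. {l \<bullet> \<tau> b<..<u \<bullet> \<tau> b})"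
      by (simp add: M_def emeasure_distr)
    also have "\<dots> = (\<Prod>b\<in>B. emeasure lborel {l \<bullet> \<tau> b<..<u \<bullet> \<tau> b})"
      by (rule F.measure_times) simp
    also have "\<dots> = (\<Prod>b\<in>B. ennreal ((u - l) \<bullet> \<tau> b))"
      using lu \<tau>B by (intro prod.cong) (auto simp: inner_diff_left)
    also have "\<dots> = (\<Prod>j\<in>Basis. ennreal ((u - l) \<bullet> j))"
      by (rule prod.reindex_bij_betw[OF \<tau>])
    also have "\<dots> = ennreal (\<Prod>j\<in>Basis. (u - l) \<bullet> j)"
      using lu by (intro prod_ennreal) (auto simp: inner_diff_left)
    finally show "emeasure M (box l u) = (\<Prod>j\<in>Basis. (u - l) \<bullet> j)" .
  qed (simp add: M_def)
  then have "lborel = distr M borel L"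
    using distr_lborel_orthogonal[OF L] by simp
  also have "\<dots> = distr (\<Pi>\<^sub>M b\<in>B. lborel) borel (\<lambda>f. L (\<Sum>b\<in>B. f b *\<^sub>R \<tau> b))"
    unfolding M_def by (subst distr_distr) (auto simp: comp_def)
  also have "(\<lambda>f. L (\<Sum>b\<in>B. f b *\<^sub>R \<tau> b)) = (\<lambda>f. \<Sum>b\<in>B. f b *\<^sub>R b)"
    by (auto simp: L_def coord intro!: ext sum.cong)
  finally show ?thesis .
qed


lemma emeasure_interval_plus:
  fixes I :: "real set"
  assumes I: "convex I" "compact I" and t: "t \<ge> 0"
  shows "emeasure lborel {s + r | s r. s \<in> I \<and> 0 \<le> r \<and> r \<le> t} = emeasure lborel I + (if I = {} then 0 else ennreal t)"
proof (cases "I = {}")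
  case False
  obtain a b where ab: "I = {a..b}"
    using I connected_compact_interval_1[of I] convex_connected by blast
  with False have "a \<le> b" by auto
  have "{s + r | s r. s \<in> I \<and> 0 \<le> r \<and> r \<le> t} = {a..b + t}"
  proof (intro equalityI subsetI)
    fix x assume "x \<in> {a..b + t}"
    then show "x \<in> {s + r | s r. s \<in> I \<and> 0 \<le> r \<and> r \<le> t}"
      using \<open>a \<le> b\<close> t unfolding ab
      by (intro CollectI exI[of _ "min x b"] exI[of _ "x - min x b"]) (auto simp: min_def)
  qed (auto simp: ab)
  then show ?thesis
    using \<open>a \<le> b\<close> t False by (simp add: ab flip: ennreal_plus)
qed simp

text \<open>Adding the segment lengthens every nonempty slice of \<open>D\<close> parallel to \<open>\<theta>\<close>, an interval, by \<open>t\<close>, and the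
  nonempty slices are indexed by the projection of \<open>D\<close>. Integrating over \<open>perp \<theta>\<close> gives the formula. The measurability
  and finiteness statements allow projections to be compared by inclusion.\<close>

theorem vol_plus_segment:
  fixes \<theta> :: "real^'n"
  assumes \<theta>: "norm \<theta> = 1" and D: "convex D" "compact D" and t: "t \<ge> 0"
  defines "\<mu> \<equiv> subspace_lborel (perp \<theta>)"
  shows "vol (D + closed_segment 0 (t *\<^sub>R \<theta>)) = vol D + t * measure \<mu> (proj_perp \<theta> ` D)"
    and "emeasure \<mu> (proj_perp \<theta> ` D) < \<infinity>" and "proj_perp \<theta> ` D \<in> sets \<mu>"
proof -
  \<comment> \<open>B is the basis that the definition of \<open>subspace_lborel\<close> picks; it is completed by \<theta> to a basis of the whole space.\<close>
  define B where "B = (SOME B. orthonormal_basis_of (perp \<theta>) B)"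
  have "subspace (perp \<theta>)"
    by (auto simp: subspace_def perp_def orthogonal_def inner_add_right)
  then have "orthonormal_basis_of (perp \<theta>) B"
    unfolding B_def by (rule someI_ex[OF orthonormal_basis_of_exists])
  then have B: "pairwise orthogonal B" "\<And>b. b \<in> B \<Longrightarrow> norm b = 1" "span B = perp \<theta>"
    by (auto simp: orthonormal_basis_of_def)
  have \<theta>\<theta>: "\<theta> \<bullet> \<theta> = 1" using \<theta> by (simp add: dot_square_norm)
  have B\<theta>: "b \<bullet> \<theta> = 0" if "b \<in> span B" for b
    using that by (simp add: B(3) perp_def orthogonal_def inner_commute)
  have \<theta>B: "\<theta> \<notin> B" using B\<theta>[OF span_base, of \<theta>] \<theta>\<theta> by auto
  have "0 \<notin> B" using B(2) by force
  then have fin: "finite B"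
    using B(1) pairwise_orthogonal_independent independent_imp_finite by blast
  interpret P: product_sigma_finite "\<lambda>_::real^'n. lborel :: real measure" by standard
  define \<nu> where "\<nu> = (\<Pi>\<^sub>M b\<in>B. lborel :: real measure)"
  define v where "v f = (\<Sum>b\<in>B. f b *\<^sub>R b)" for f
  have vm[measurable]: "v \<in> borel_measurable \<nu>" by (simp add: v_def[abs_def] \<nu>_def)
  have \<mu>: "\<mu> = distr \<nu> borel v"
    by (simp add: \<mu>_def subspace_lborel_def Let_def B_def[symmetric] \<nu>_def v_def[abs_def])
  have vB: "v f \<in> span B" for f unfolding v_def by (intro span_sum span_scale span_base)
  have "span (insert \<theta> B) = UNIV"
  proof -
    have "x \<in> span (insert \<theta> B)" for x
    proof -
      have "x - (x \<bullet> \<theta>) *\<^sub>R \<theta> \<in> span B"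
        using \<theta>\<theta> by (simp add: B(3) perp_def orthogonal_def inner_diff_right inner_commute)
      then show ?thesis unfolding span_insert by blast
    qed
    then show ?thesis by blast
  qed
  moreover have "pairwise orthogonal (insert \<theta> B)"
    using B(1) B\<theta>[OF span_base] by (auto simp: pairwise_insert orthogonal_def inner_commute)
  ultimately have lb: "lborel = distr (\<Pi>\<^sub>M b\<in>insert \<theta> B. lborel) borel (\<lambda>f. \<Sum>b\<in>insert \<theta> B. f b *\<^sub>R b)"
    using B(2) \<theta> by (intro lborel_eq_distr_orthonormal) auto
  have fubini: "emeasure lborel S = (\<integral>\<^sup>+ f. emeasure lborel {s. s *\<^sub>R \<theta> + v f \<in> S} \<partial>\<nu>)"
    if S[measurable]: "S \<in> sets borel" for S
  proof -
    have "emeasure lborel S = (\<integral>\<^sup>+ x. indicator S x \<partial>lborel)" by simp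
    also have "\<dots> = (\<integral>\<^sup>+ f. indicator S (\<Sum>b\<in>insert \<theta> B. f b *\<^sub>R b) \<partial>(\<Pi>\<^sub>M b\<in>insert \<theta> B. lborel))"
      by (subst lb, subst nn_integral_distr) auto
    also have "\<dots> = (\<integral>\<^sup>+ f. (\<integral>\<^sup>+ s. indicator S (\<Sum>b\<in>insert \<theta> B. (f(\<theta> := s)) b *\<^sub>R b) \<partial>lborel) \<partial>\<nu>)"
      unfolding \<nu>_def by (rule P.product_nn_integral_insert) (use fin \<theta>B in auto)
    also have "\<dots> = (\<integral>\<^sup>+ f. emeasure lborel {s. s *\<^sub>R \<theta> + v f \<in> S} \<partial>\<nu>)"
    proof (rule nn_integral_cong)
      fix f
      have "(\<Sum>b\<in>insert \<theta> B. (f(\<theta> := s)) b *\<^sub>R b) = s *\<^sub>R \<theta> + v f" for s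
        using fin \<theta>B by (simp add: v_def) (intro sum.cong, auto)
      moreover have "{s. s *\<^sub>R \<theta> + v f \<in> S} \<in> sets borel" by measurable
      moreover have "indicator S (s *\<^sub>R \<theta> + v f) = (indicator {s. s *\<^sub>R \<theta> + v f \<in> S} s :: ennreal)" for s
        by (simp add: indicator_def)
      ultimately show "(\<integral>\<^sup>+ s. indicator S (\<Sum>b\<in>insert \<theta> B. (f(\<theta> := s)) b *\<^sub>R b) \<partial>lborel)
          = emeasure lborel {s. s *\<^sub>R \<theta> + v f \<in> S}"
        by simp
    qed
    finally show ?thesis .
  qed
  have projv: "proj_perp \<theta> (s *\<^sub>R \<theta> + v f) = v f" for s f
    using B\<theta>[OF vB[of f]] \<theta>\<theta> by (simp add: proj_perp_def inner_add_left)
  have comp: "compact (proj_perp \<theta> ` D)"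
    by (intro compact_continuous_image D) (auto simp: proj_perp_def[abs_def] intro!: continuous_intros)
  then have PD[measurable]: "proj_perp \<theta> ` D \<in> sets borel" by (rule borel_compact)
  then show "proj_perp \<theta> ` D \<in> sets \<mu>" by (simp add: \<mu>)
  have D'c: "compact (D + closed_segment 0 (t *\<^sub>R \<theta>))" for t
    by (intro compact_set_plus D) simp
  \<comment> \<open>The identity is first proved for extended values; t = 1 then shows that the projection has finite measure.\<close>
  have main: "emeasure lborel (D + closed_segment 0 (t *\<^sub>R \<theta>)) = emeasure lborel D + ennreal t * emeasure \<mu> (proj_perp \<theta> ` D)"
    if t: "t \<ge> 0" for t
  proof -
    have "emeasure lborel {s. s *\<^sub>R \<theta> + v f \<in> D + closed_segment 0 (t *\<^sub>R \<theta>)}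
        = emeasure lborel {s. s *\<^sub>R \<theta> + v f \<in> D} + ennreal t * indicator (proj_perp \<theta> ` D) (v f)" for f
    proof -
      define I where "I = {s. s *\<^sub>R \<theta> + v f \<in> D}"
      have seg: "closed_segment 0 (t *\<^sub>R \<theta>) = {r *\<^sub>R \<theta> | r. 0 \<le> r \<and> r \<le> t}"
      proof (intro equalityI subsetI)
        fix x assume "x \<in> closed_segment 0 (t *\<^sub>R \<theta>)"
        then show "x \<in> {r *\<^sub>R \<theta> | r. 0 \<le> r \<and> r \<le> t}"
          using t by (auto simp: in_segment mult_left_le_one_le)
      next
        fix x assume "x \<in> {r *\<^sub>R \<theta> | r. 0 \<le> r \<and> r \<le> t}"
        then obtain r where r: "x = r *\<^sub>R \<theta>" "0 \<le> r" "r \<le> t" by blast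
        show "x \<in> closed_segment 0 (t *\<^sub>R \<theta>)"
          unfolding in_segment using r by (intro exI[of _ "r / t"]) (auto simp: field_simps)
      qed
      have "convex I"
        unfolding I_def convex_alt
      proof clarsimp
        fix x y w :: real assume xy: "x *\<^sub>R \<theta> + v f \<in> D" "y *\<^sub>R \<theta> + v f \<in> D" "0 \<le> w" "w \<le> 1"
        have "(1 - w) *\<^sub>R (x *\<^sub>R \<theta> + v f) + w *\<^sub>R (y *\<^sub>R \<theta> + v f) \<in> D"
          using D(1) xy unfolding convex_alt by blast
        then show "((1 - w) * x + w * y) *\<^sub>R \<theta> + v f \<in> D"
          by (simp add: algebra_simps)
      qed
      moreover have "compact I"
      proof (intro compact_eq_bounded_closed[THEN iffD2] conjI)
        obtain r where r: "\<And>x. x \<in> D \<Longrightarrow> norm x \<le> r"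
          using compact_imp_bounded[OF D(2)] unfolding bounded_iff by blast
        have "\<bar>s\<bar> \<le> r + norm (v f)" if "s \<in> I" for s
        proof -
          have "\<bar>s\<bar> = norm ((s *\<^sub>R \<theta> + v f) - v f)" using \<theta> by simp
          also have "\<dots> \<le> norm (s *\<^sub>R \<theta> + v f) + norm (v f)" by (rule norm_triangle_ineq4)
          finally show ?thesis using r that unfolding I_def by fastforce
        qed
        then show "bounded I" by (intro boundedI[of _ "r + norm (v f)"]) auto
        show "closed I"
          unfolding I_def
          by (intro closed_vimage[OF compact_imp_closed[OF D(2)], unfolded vimage_def] continuous_intros)
      qed
      moreover have "{s. s *\<^sub>R \<theta> + v f \<in> D + closed_segment 0 (t *\<^sub>R \<theta>)} = {s + r | s r. s \<in> I \<and> 0 \<le> r \<and> r \<le> t}"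
      proof (intro equalityI subsetI)
        fix s assume "s \<in> {s. s *\<^sub>R \<theta> + v f \<in> D + closed_segment 0 (t *\<^sub>R \<theta>)}"
        then obtain d r where d: "d \<in> D" "0 \<le> r" "r \<le> t" "s *\<^sub>R \<theta> + v f = d + r *\<^sub>R \<theta>"
          unfolding seg by (auto simp: set_plus_def)
        then have "d = (s - r) *\<^sub>R \<theta> + v f" by (simp add: algebra_simps)
        with d have "s - r \<in> I" by (simp add: I_def)
        with d show "s \<in> {s + r | s r. s \<in> I \<and> 0 \<le> r \<and> r \<le> t}"
          by (intro CollectI exI[of _ "s - r"] exI[of _ r]) simp
      next
        fix x assume "x \<in> {s + r | s r. s \<in> I \<and> 0 \<le> r \<and> r \<le> t}"
        then obtain s r where "x = s + r" "s *\<^sub>R \<theta> + v f \<in> D" "0 \<le> r" "r \<le> t" by (auto simp: I_def)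
        then have "(s *\<^sub>R \<theta> + v f) + r *\<^sub>R \<theta> \<in> D + closed_segment 0 (t *\<^sub>R \<theta>)"
          unfolding seg by (intro set_plus_intro) auto
        then show "x \<in> {s. s *\<^sub>R \<theta> + v f \<in> D + closed_segment 0 (t *\<^sub>R \<theta>)}"
          using \<open>x = s + r\<close> by (simp add: algebra_simps)
      qed
      moreover have "I = {} \<longleftrightarrow> v f \<notin> proj_perp \<theta> ` D"
      proof -
        have "v f \<in> proj_perp \<theta> ` D" if "s \<in> I" for s
          using that projv[of s f] unfolding I_def by (metis image_eqI mem_Collect_eq)
        moreover have "\<exists>s. s \<in> I" if shadow: "v f \<in> proj_perp \<theta> ` D"
        proof -
          obtain d where d: "d \<in> D" "v f = proj_perp \<theta> d" using shadow by blast
          then have "(d \<bullet> \<theta>) *\<^sub>R \<theta> + v f = d" by (simp add: proj_perp_def)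
          with d show ?thesis unfolding I_def by (metis mem_Collect_eq)
        qed
        ultimately show ?thesis by blast
      qed
      ultimately show ?thesis
        using emeasure_interval_plus[of I t] t by (simp add: I_def[symmetric] indicator_def)
    qed
    then have "emeasure lborel (D + closed_segment 0 (t *\<^sub>R \<theta>))
        = (\<integral>\<^sup>+ f. emeasure lborel {s. s *\<^sub>R \<theta> + v f \<in> D} + ennreal t * indicator (proj_perp \<theta> ` D) (v f) \<partial>\<nu>)"
      by (subst fubini) (auto intro: borel_compact D'c)
    also have "\<dots> = emeasure lborel D + (\<integral>\<^sup>+ f. ennreal t * indicator (proj_perp \<theta> ` D) (v f) \<partial>\<nu>)"
    proof (subst nn_integral_add)
      have [measurable]: "D \<in> sets borel" using D(2) by (rule borel_compact)
      have "Measurable.pred (\<nu> \<Otimes>\<^sub>M lborel) (\<lambda>x. snd x *\<^sub>R \<theta> + v (fst x) \<in> D)" by measurable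
      then have "{x \<in> space (\<nu> \<Otimes>\<^sub>M lborel). snd x *\<^sub>R \<theta> + v (fst x) \<in> D} \<in> sets (\<nu> \<Otimes>\<^sub>M lborel)" (is "?Q \<in> _") by measurable
      then have "(\<lambda>f. emeasure lborel (Pair f -` ?Q)) \<in> borel_measurable \<nu>"
        by (rule lborel.measurable_emeasure_Pair)
      then show "(\<lambda>f. emeasure lborel {s. s *\<^sub>R \<theta> + v f \<in> D}) \<in> borel_measurable \<nu>"
        by (rule measurable_cong[THEN iffD1, rotated]) (auto simp: space_pair_measure intro!: arg_cong[where f = "emeasure lborel"])
      show "(\<integral>\<^sup>+ f. emeasure lborel {s. s *\<^sub>R \<theta> + v f \<in> D} \<partial>\<nu>) + (\<integral>\<^sup>+ f. ennreal t * indicator (proj_perp \<theta> ` D) (v f) \<partial>\<nu>)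
          = emeasure lborel D + (\<integral>\<^sup>+ f. ennreal t * indicator (proj_perp \<theta> ` D) (v f) \<partial>\<nu>)"
        by (subst fubini[of D]) (auto intro: borel_compact D)
    qed measurable
    also have "(\<integral>\<^sup>+ f. ennreal t * indicator (proj_perp \<theta> ` D) (v f) \<partial>\<nu>) = ennreal t * emeasure \<mu> (proj_perp \<theta> ` D)"
    proof -
      have "(\<integral>\<^sup>+ x. indicator (proj_perp \<theta> ` D) x \<partial>\<mu>) = (\<integral>\<^sup>+ f. indicator (proj_perp \<theta> ` D) (v f) \<partial>\<nu>)"
        unfolding \<mu> by (intro nn_integral_distr) auto
      then show ?thesis
        using \<open>_ \<in> sets \<mu>\<close> by (subst nn_integral_cmult) (auto, measurable)
    qed
    finally show ?thesis .
  qed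
  have finD: "emeasure lborel (D + closed_segment 0 (t *\<^sub>R \<theta>)) < \<infinity>" for t
    using D'c compact_imp_bounded emeasure_bounded_finite by blast
  show fin\<mu>: "emeasure \<mu> (proj_perp \<theta> ` D) < \<infinity>"
    using main[of 1] finD[of 1] by auto
  have finD0: "emeasure lborel D < \<infinity>" using D(2) compact_imp_bounded emeasure_bounded_finite by blast
  have "measure lborel (D + closed_segment 0 (t *\<^sub>R \<theta>)) = measure lborel D + t * measure \<mu> (proj_perp \<theta> ` D)"
    unfolding measure_def main[OF t] using fin\<mu> finD0 t
    by (subst enn2real_plus) (auto simp: enn2real_mult ennreal_mult_less_top)
  then show "vol (D + closed_segment 0 (t *\<^sub>R \<theta>)) = vol D + t * measure \<mu> (proj_perp \<theta> ` D)"
    using D'c D(2) by (simp add: measure_completion borel_compact)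
qed

section \<open>Shadows and Minkowski's first inequality for zonotopes\<close>

text \<open>The support function of the projection body. Written as an increment of volume it refers to no measure on
  hyperplanes, and its behaviour under linear maps can be read off; \<open>shadow_unit\<close> gives its geometric meaning.\<close>

definition shadow :: "'a::euclidean_space set \<Rightarrow> 'a \<Rightarrow> real" where
  "shadow D z = vol (D + closed_segment 0 z) - vol D"

lemma shadow_unit:
  fixes \<theta> :: "real^'n"
  assumes "norm \<theta> = 1" "convex D" "compact D"
  shows "shadow D \<theta> = measure (subspace_lborel (perp \<theta>)) (proj_perp \<theta> ` D)"
  using vol_plus_segment(1)[OF assms, of 1] by (simp add: shadow_def)

lemma shadow_zero [simp]: "shadow D 0 = 0"
  by (simp add: shadow_def set_plus_def)

lemma shadow_scaleR:
  fixes z :: "real^'n"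
  assumes D: "convex D" "compact D" and t: "t \<ge> 0"
  shows "shadow D (t *\<^sub>R z) = t * shadow D z"
proof (cases "z = 0")
  case False
  define \<theta> where "\<theta> = z /\<^sub>R norm z"
  have \<theta>: "norm \<theta> = 1" "z = norm z *\<^sub>R \<theta>" using False by (auto simp: \<theta>_def)
  have "shadow D (s *\<^sub>R \<theta>) = s * measure (subspace_lborel (perp \<theta>)) (proj_perp \<theta> ` D)" if "s \<ge> 0" for s
    using vol_plus_segment(1)[OF \<theta>(1) D that] by (simp add: shadow_def)
  from this[of "t * norm z"] this[of "norm z"]
  have "shadow D (t *\<^sub>R (norm z *\<^sub>R \<theta>)) = t * shadow D (norm z *\<^sub>R \<theta>)"
    using t by simp
  then show ?thesis unfolding \<theta>(2)[symmetric] .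
qed simp

lemma vol_plus_scaled_segment:
  fixes z :: "real^'n"
  assumes "convex D" "compact D" "t \<ge> 0"
  shows "vol (D + closed_segment 0 (t *\<^sub>R z)) = vol D + t * shadow D z"
  using shadow_scaleR[OF assms, of z] by (simp add: shadow_def)

text \<open>For unit vectors the shadow is the volume of a projection, and projecting preserves inclusions.\<close>

lemma shadow_mono:
  fixes z :: "real^'n"
  assumes D: "convex D" "compact D" and E: "convex E" "compact E" and "D \<subseteq> E"
  shows "shadow D z \<le> shadow E z"
proof (cases "z = 0")
  case False
  define \<theta> where "\<theta> = z /\<^sub>R norm z"
  have \<theta>: "norm \<theta> = 1" "z = norm z *\<^sub>R \<theta>" using False by (auto simp: \<theta>_def)
  have "shadow D \<theta> \<le> shadow E \<theta>"
    unfolding shadow_unit[OF \<theta>(1) D] shadow_unit[OF \<theta>(1) E]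
    using vol_plus_segment(3)[OF \<theta>(1) D, of 0] vol_plus_segment(2,3)[OF \<theta>(1) E, of 0] \<open>D \<subseteq> E\<close>
    by (intro measure_mono_fmeasurable image_mono fmeasurableI) auto
  then show ?thesis
    using shadow_scaleR[OF D, of "norm z" \<theta>] shadow_scaleR[OF E, of "norm z" \<theta>]
    by (simp add: mult_left_mono flip: \<theta>(2))
qed simp

lemma shadow_nonneg:
  fixes z :: "real^'n"
  assumes D: "convex D" "compact D"
  shows "shadow D z \<ge> 0"
  using shadow_mono[of "{}" D z] D by (simp add: shadow_def set_plus_def)

lemma image_set_plus:
  assumes "linear f"
  shows "f ` (S + T) = f ` S + f ` T"
proof (intro equalityI subsetI)
  fix x assume "x \<in> f ` S + f ` T"
  then obtain a b where "a \<in> S" "b \<in> T" "x = f a + f b" by (auto simp: set_plus_def)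
  then show "x \<in> f ` (S + T)"
    using assms by (intro image_eqI[of _ _ "a + b"]) (auto simp: linear_add)
next
  fix x assume "x \<in> f ` (S + T)"
  then obtain a b where "a \<in> S" "b \<in> T" "x = f a + f b"
    by (auto simp: set_plus_def linear_add[OF assms])
  then show "x \<in> f ` S + f ` T" by blast
qed

lemma shadow_linear_image:
  fixes f :: "real^'n \<Rightarrow> real^'n"
  assumes f: "linear f" and D: "compact D"
  shows "shadow (f ` D) (f z) = \<bar>det (matrix f)\<bar> * shadow D z"
proof -
  have "f ` (D + closed_segment 0 z) = f ` D + closed_segment 0 (f z)"
    using closed_segment_linear_image[OF f, of 0 z] by (simp add: image_set_plus[OF f] linear_0[OF f])
  moreover have "D + closed_segment 0 z \<in> lmeasurable"
    by (intro lmeasurable_compact compact_set_plus D) simp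
  ultimately show ?thesis
    using measure_linear_image_det(2)[OF f, of "D + closed_segment 0 z"]
      measure_linear_image_det(2)[OF f lmeasurable_compact[OF D]]
    by (simp add: shadow_def right_diff_distrib)
qed

text \<open>Scaling everything by \<open>s\<close> multiplies volumes by \<open>s^n\<close>, but it also lengthens the segment, which accounts for
  one factor \<open>s\<close>.\<close>

lemma shadow_scale_body:
  fixes z :: "real^'n"
  assumes D: "convex D" "compact D" and s: "s > 0"
  shows "shadow ((\<lambda>x. s *\<^sub>R x) ` D) z = s ^ (CARD('n) - 1) * shadow D z"
proof -
  have lin: "linear (\<lambda>x::real^'n. s *\<^sub>R x)" by (rule linear_scaleR)
  have vol: "vol ((\<lambda>x. s *\<^sub>R x) ` S) = s ^ CARD('n) * vol S" for S :: "(real^'n) set"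
    using measure_lebesgue_affine[of s 0 S] s by simp
  have "(\<lambda>x. s *\<^sub>R x) ` (D + closed_segment 0 (z /\<^sub>R s)) = (\<lambda>x. s *\<^sub>R x) ` D + closed_segment 0 z"
    using s by (simp add: image_set_plus[OF lin] closed_segment_linear_image[OF lin, symmetric])
  then have "shadow ((\<lambda>x. s *\<^sub>R x) ` D) z = s ^ CARD('n) * shadow D (z /\<^sub>R s)"
    unfolding shadow_def by (metis vol right_diff_distrib)
  also have "\<dots> = s ^ CARD('n) / s * shadow D z"
    using shadow_scaleR[OF D, of "inverse s" z] s by (simp add: divide_inverse)
  also have "s ^ CARD('n) / s = s ^ (CARD('n) - 1)"
    using s by (simp add: power_diff)
  finally show ?thesis .
qed

lemma translation_set_plus: "((+) (a::'a::ab_semigroup_add) ` S) + T = (+) a ` (S + T)"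
proof (intro equalityI subsetI)
  fix x assume "x \<in> (+) a ` S + T"
  then show "x \<in> (+) a ` (S + T)" by (fastforce simp: set_plus_def add.assoc)
next
  fix x assume "x \<in> (+) a ` (S + T)"
  then obtain s t where "s \<in> S" "t \<in> T" "x = (a + s) + t" by (auto simp: set_plus_def add.assoc)
  then show "x \<in> (+) a ` S + T" by blast
qed

lemma shadow_translation: "shadow ((+) a ` D) z = shadow D z"
  by (simp add: shadow_def translation_set_plus measure_translation)

text \<open>The segments start at 0 instead of being centred, so that a zonotope contains the zonotopes of
  its subfamilies.\<close>

definition zonotope :: "'i set \<Rightarrow> ('i \<Rightarrow> 'a::euclidean_space) \<Rightarrow> 'a set" where
  "zonotope I z = (\<Sum>i\<in>I. closed_segment 0 (z i))"

lemma zonotope_insert: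
  "finite I \<Longrightarrow> j \<notin> I \<Longrightarrow> zonotope (insert j I) z = zonotope I z + closed_segment 0 (z j)"
  by (simp add: zonotope_def add.commute)

lemma convex_zonotope: "convex (zonotope I z)"
  unfolding zonotope_def by (intro convex_set_sum) simp

lemma compact_zonotope: "finite I \<Longrightarrow> compact (zonotope I z)"
proof (induction I rule: finite_induct)
  case empty
  then show ?case by (simp add: zonotope_def set_zero)
qed (simp add: zonotope_insert compact_set_plus)

lemma zonotope_mono: 
  assumes "finite I" "J \<subseteq> I"
  shows "zonotope J z \<subseteq> zonotope I z"
proof -
  have "0 \<in> zonotope (I - J) z"
    unfolding zonotope_def set_sum_alt[OF finite_Diff[OF assms(1)]]
    by (intro CollectI exI[of _ "\<lambda>_. 0"]) simp
  then have "zonotope J z \<subseteq> zonotope (I - J) z + zonotope J z"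
    by (metis set_zero_plus2)
  also have "\<dots> = zonotope I z"
    unfolding zonotope_def using assms by (metis sum.subset_diff)
  finally show ?thesis .
qed

lemma zonotope_linear_image:
  assumes "finite I" "linear f"
  shows "zonotope I (\<lambda>i. f (z i)) = f ` zonotope I z"
  using assms(1)
proof (induction I rule: finite_induct)
  case empty
  then show ?case by (simp add: zonotope_def set_zero linear_0[OF assms(2)])
next
  case (insert j I)
  have "closed_segment 0 (f (z j)) = f ` closed_segment 0 (z j)"
    using closed_segment_linear_image[OF assms(2), of 0 "z j"] by (simp add: linear_0[OF assms(2)])
  with insert show ?case
    by (simp add: zonotope_insert image_set_plus[OF assms(2)])
qed

lemma zonotope_scaleR:
  "finite I \<Longrightarrow> zonotope I (\<lambda>i. t *\<^sub>R z i) = (\<lambda>x. t *\<^sub>R x) ` zonotope I z"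
  by (rule zonotope_linear_image[OF _ linear_scaleR])

lemma vol_zonotope_scaleR:
  fixes z :: "'i \<Rightarrow> real^'n"
  assumes "finite I" "t \<ge> 0"
  shows "vol (zonotope I (\<lambda>i. t *\<^sub>R z i)) = t ^ CARD('n) * vol (zonotope I z)"
  using measure_lebesgue_affine[of t 0 "zonotope I z"] assms by (simp add: zonotope_scaleR)

text \<open>By convexity \<open>C + (k * t) C = (1 + k * t) C\<close>.\<close>

lemma plus_scaled_subset_dilate:
  fixes C Z :: "'a::real_vector set"
  assumes C: "convex C" and Z: "Z \<subseteq> (\<lambda>x. k *\<^sub>R x) ` C" and t: "t \<ge> 0" "k \<ge> 0"
  shows "C + (\<lambda>x. t *\<^sub>R x) ` Z \<subseteq> (\<lambda>x. (1 + k * t) *\<^sub>R x) ` C"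
proof
  fix x assume "x \<in> C + (\<lambda>x. t *\<^sub>R x) ` Z"
  then obtain c d where cd: "c \<in> C" "d \<in> C" "x = c + t *\<^sub>R (k *\<^sub>R d)"
    using Z by (fastforce simp: set_plus_def)
  have pos: "1 + k * t > 0" using t by (simp add: add_pos_nonneg)
  have "(1 / (1 + k * t)) *\<^sub>R c + (k * t / (1 + k * t)) *\<^sub>R d \<in> C"
    using t pos by (intro convexD[OF C cd(1,2)]) (auto simp: add_divide_distrib[symmetric])
  moreover have "x = (1 + k * t) *\<^sub>R ((1 / (1 + k * t)) *\<^sub>R c + (k * t / (1 + k * t)) *\<^sub>R d)"
    using pos cd(3) by (simp add: scaleR_add_right mult.commute)
  ultimately show "x \<in> (\<lambda>x. (1 + k * t) *\<^sub>R x) ` C" by blast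
qed

lemma bounded_subset_dilate:
  fixes C Z :: "'a::euclidean_space set"
  assumes "bounded Z" "0 \<in> interior C"
  obtains k where "k > 0" "Z \<subseteq> (\<lambda>x. k *\<^sub>R x) ` C"
proof -
  obtain r where r: "r > 0" "ball 0 r \<subseteq> C" using assms(2) mem_interior by blast
  obtain R where R: "R > 0" "Z \<subseteq> ball 0 R" using assms(1) bounded_subset_ballD by blast
  have "z \<in> (\<lambda>x. (R / r) *\<^sub>R x) ` C" if "z \<in> Z" for z
  proof (rule image_eqI[of _ _ "(r / R) *\<^sub>R z"])
    have "norm z < R" using R that by auto
    then have "(r / R) *\<^sub>R z \<in> ball 0 r" using r R by (simp add: field_simps)
    then show "(r / R) *\<^sub>R z \<in> C" using r by blast
  qed (use r R in simp)
  then show ?thesis using r R by (intro that[of "R / r"]) auto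
qed

text \<open>Adding the segments one after another, every increment of volume is the shadow of a body inside \<open>E\<close>.\<close>

lemma vol_plus_zonotope_le:
  fixes z :: "'i \<Rightarrow> real^'n"
  assumes I: "finite I" and C: "convex C" "compact C" and E: "convex E" "compact E"
    and sub: "C + zonotope I (\<lambda>i. t *\<^sub>R z i) \<subseteq> E" and t: "t \<ge> 0"
  shows "vol (C + zonotope I (\<lambda>i. t *\<^sub>R z i)) \<le> vol C + t * (\<Sum>i\<in>I. shadow E (z i))"
proof -
  have "vol (C + zonotope J (\<lambda>i. t *\<^sub>R z i)) \<le> vol C + t * (\<Sum>i\<in>J. shadow E (z i))" if "J \<subseteq> I" for J
    using finite_subset[OF that I] that
  proof (induction J rule: finite_induct)
    case empty
    then show ?case by (simp add: zonotope_def)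
  next
    case (insert j J)
    let ?D = "C + zonotope J (\<lambda>i. t *\<^sub>R z i)"
    have D: "convex ?D" "compact ?D"
      using insert by (auto intro: convex_set_plus compact_set_plus C convex_zonotope compact_zonotope)
    have "?D \<subseteq> E"
      using sub insert.prems zonotope_mono[OF I, of J "\<lambda>i. t *\<^sub>R z i"] by (meson insert_subset order_refl order_trans set_plus_mono2)
    then have "shadow ?D (z j) \<le> shadow E (z j)" by (rule shadow_mono[OF D E])
    then have "t * shadow ?D (z j) \<le> t * shadow E (z j)" using t by (rule mult_left_mono)
    moreover have "vol (C + zonotope (insert j J) (\<lambda>i. t *\<^sub>R z i)) = vol ?D + t * shadow ?D (z j)"
      using insert.hyps vol_plus_scaled_segment[OF D t, of "z j"] by (simp add: zonotope_insert add.assoc)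
    ultimately show ?case
      using insert by (simp add: distrib_left)
  qed
  then show ?thesis by blast
qed

text \<open>The volume of \<open>C + t Z\<close> is bounded below by the Brunn--Minkowski inequality and above by
  \<open>vol_plus_zonotope_le\<close> with a dilate of \<open>C\<close> as the enclosing body. The two bounds agree for \<open>t = 0\<close>; the claim is
  the comparison of their derivatives there.\<close>

theorem minkowski_first_inequality_zonotope:
  fixes z :: "'i \<Rightarrow> real^'n"
  assumes I: "finite I" and C: "convex C" "compact C" "interior C \<noteq> {}"
  shows "real CARD('n) ^ CARD('n) * vol C ^ (CARD('n) - 1) * vol (zonotope I z) \<le> (\<Sum>i\<in>I. shadow C (z i)) ^ CARD('n)"
proof -
  let ?n = "CARD('n)"
  let ?r = "root ?n"
  have main: "real ?n ^ ?n * vol C ^ (?n - 1) * vol (zonotope I z) \<le> (\<Sum>i\<in>I. shadow C (z i)) ^ ?n"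
    if C: "convex C" "compact C" and 0: "0 \<in> interior C" for C :: "(real^'n) set"
  proof -
    define Z where "Z = zonotope I z"
    define H where "H = (\<Sum>i\<in>I. shadow C (z i))"
    have Z: "convex Z" "compact Z" by (auto simp: Z_def convex_zonotope compact_zonotope I)
    have H: "H \<ge> 0" unfolding H_def using C by (intro sum_nonneg shadow_nonneg)
    \<comment> \<open>A degenerate zonotope has volume 0, and then the claim is trivial.\<close>
    have intneg: "vol Z = 0" if "interior Z = {}"
      using vol_interior_convex[OF Z] that by simp
    show ?thesis
    proof (cases "interior Z = {}")
      case True
      then have "vol (zonotope I z) = 0" using intneg by (simp add: Z_def)
      moreover have "0 \<le> H ^ ?n" using H by simp
      ultimately show ?thesis by (simp add: H_def)
    next
      case False
      define a b where "a = ?r (vol C)" and "b = ?r (vol Z)"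
      have an: "a ^ ?n = vol C" and bn: "b ^ ?n = vol Z" by (simp_all add: a_def b_def)
      have "vol C > 0" using vol_pos_convex[OF C] 0 by blast
      then have a: "a > 0" by (simp add: a_def)
      have b: "b \<ge> 0" by (simp add: b_def)
      obtain k where k: "k > 0" "Z \<subseteq> (\<lambda>x. k *\<^sub>R x) ` C"
        using bounded_subset_dilate[OF compact_imp_bounded[OF Z(2)] 0] .
      have *: "?n * a ^ (?n - 1) * b \<le> (1 + k * t) ^ (?n - 1) * H" if t: "t > 0" for t
      proof -
        let ?E = "(\<lambda>x. (1 + k * t) *\<^sub>R x) ` C"
        let ?tZ = "zonotope I (\<lambda>i. t *\<^sub>R z i)"
        have tZ: "?tZ = (\<lambda>x. t *\<^sub>R x) ` Z" using I by (simp add: zonotope_scaleR Z_def)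
        have E: "convex ?E" "compact ?E"
          using C by (auto intro: convex_scaling compact_scaling)
        have "interior ?tZ = (\<lambda>x. t *\<^sub>R x) ` interior Z"
          unfolding tZ using t by (intro interior_injective_linear_image linear_scaleR) (auto simp: inj_on_def)
        then have tZ': "interior ?tZ \<noteq> {}" using False by simp
        have "a + t * b = ?r (vol C) + ?r (vol ?tZ)"
          using t by (simp add: vol_zonotope_scaleR[OF I] real_root_mult real_root_power_cancel a_def b_def Z_def)
        also have "\<dots> \<le> ?r (vol (C + ?tZ))"
          using brunn_minkowski_convex[OF C _ convex_zonotope compact_zonotope[OF I] tZ'] 0 by auto
        finally have "(a + t * b) ^ ?n \<le> ?r (vol (C + ?tZ)) ^ ?n"
          using a b t by (intro power_mono) auto
        then have "(a + t * b) ^ ?n \<le> vol (C + ?tZ)" by simp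
        also have "\<dots> \<le> vol C + t * (\<Sum>i\<in>I. shadow ?E (z i))"
          using plus_scaled_subset_dilate[OF C(1) k(2), of t] t k(1)
          by (intro vol_plus_zonotope_le[OF I C E]) (auto simp: tZ)
        also have "(\<Sum>i\<in>I. shadow ?E (z i)) = (1 + k * t) ^ (?n - 1) * H"
          using t k(1) by (simp add: shadow_scale_body[OF C] H_def sum_distrib_left add_pos_pos)
        finally have upper: "(a + t * b) ^ ?n \<le> a ^ ?n + t * ((1 + k * t) ^ (?n - 1) * H)" by (simp add: an)
        have "1 + ?n * (t * b / a) \<le> (1 + t * b / a) ^ ?n"
          using a b t by (intro Bernoulli_inequality) (simp add: order_trans[of _ 0])
        then have "a ^ ?n * (1 + ?n * (t * b / a)) \<le> a ^ ?n * (1 + t * b / a) ^ ?n"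
          using a by (intro mult_left_mono) auto
        also have "\<dots> = (a + t * b) ^ ?n"
          using a by (simp add: power_mult_distrib[symmetric] distrib_left)
        finally have "a ^ ?n + t * (?n * (a ^ ?n / a) * b) \<le> (a + t * b) ^ ?n"
          using a by (simp add: field_simps)
        moreover have "a ^ ?n / a = a ^ (?n - 1)" using a by (simp add: power_diff)
        ultimately have "t * (?n * a ^ (?n - 1) * b) \<le> t * ((1 + k * t) ^ (?n - 1) * H)"
          using upper by simp
        then show ?thesis using t by simp
      qed
      have "?n * a ^ (?n - 1) * b \<le> H"
      proof (rule tendsto_lowerbound)
        show "((\<lambda>t. (1 + k * t) ^ (?n - 1) * H) \<longlongrightarrow> H) (at_right 0)"
          by (auto intro!: tendsto_eq_intros)
        show "\<forall>\<^sub>F t in at_right 0. ?n * a ^ (?n - 1) * b \<le> (1 + k * t) ^ (?n - 1) * H"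
          using eventually_at_right_less[of "0::real"] by eventually_elim (rule *)
      qed simp
      then have "(?n * a ^ (?n - 1) * b) ^ ?n \<le> H ^ ?n"
        using a b by (intro power_mono) auto
      moreover have "(?n * a ^ (?n - 1) * b) ^ ?n = ?n ^ ?n * vol C ^ (?n - 1) * vol Z"
        by (simp add: power_mult_distrib bn power_mult[symmetric] mult.commute flip: an)
      ultimately show ?thesis by (simp add: Z_def H_def)
    qed
  qed
  obtain x where x: "x \<in> interior C" using C(3) by blast
  have "0 \<in> interior ((+) (- x) ` C)"
    unfolding interior_translation using x by (intro image_eqI[of _ _ x]) auto
  then have "real ?n ^ ?n * vol ((+) (- x) ` C) ^ (?n - 1) * vol (zonotope I z) \<le> (\<Sum>i\<in>I. shadow ((+) (- x) ` C) (z i)) ^ ?n"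
    using C by (intro main convex_translation compact_translation)
  then show ?thesis unfolding measure_translation shadow_translation .
qed

section \<open>Volumes of zonotopes and determinants\<close>

text \<open>Variables outside \<open>J\<close> are frozen at \<open>b\<close>, so that the induction over \<open>J\<close> can replace a variable by its values 0 and 1.\<close>

lemma multiaffine_expansion:
  fixes F :: "('i \<Rightarrow> real) \<Rightarrow> real"
  assumes "finite J" and b: "\<And>i. b i \<ge> 0"
    and aff: "\<And>t j s. j \<in> J \<Longrightarrow> (\<And>i. t i \<ge> 0) \<Longrightarrow> s \<ge> 0 \<Longrightarrow>
        F (t(j := s)) = F (t(j := 0)) + s * (F (t(j := 1)) - F (t(j := 0)))"
  shows "\<exists>a. \<forall>t. (\<forall>i. t i \<ge> 0) \<longrightarrow> F (\<lambda>i. if i \<in> J then t i else b i) = (\<Sum>S\<in>Pow J. a S * prod t S)"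
  using assms
proof (induction J arbitrary: b rule: finite_induct)
  case empty
  show ?case by (intro exI[of _ "\<lambda>_. F b"]) simp
next
  case (insert j J)
  obtain a0 where a0: "\<And>t. (\<forall>i. t i \<ge> 0) \<Longrightarrow> F (\<lambda>i. if i \<in> J then t i else (b(j := 0)) i) = (\<Sum>S\<in>Pow J. a0 S * prod t S)"
  proof -
    have "\<exists>a. \<forall>t. (\<forall>i. t i \<ge> 0) \<longrightarrow> F (\<lambda>i. if i \<in> J then t i else (b(j := 0)) i) = (\<Sum>S\<in>Pow J. a S * prod t S)"
      by (rule insert.IH[OF _ insert.prems(2)]) (use insert.prems(1) in simp_all)
    then show ?thesis using that by blast
  qed
  obtain a1 where a1: "\<And>t. (\<forall>i. t i \<ge> 0) \<Longrightarrow> F (\<lambda>i. if i \<in> J then t i else (b(j := 1)) i) = (\<Sum>S\<in>Pow J. a1 S * prod t S)"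
  proof -
    have "\<exists>a. \<forall>t. (\<forall>i. t i \<ge> 0) \<longrightarrow> F (\<lambda>i. if i \<in> J then t i else (b(j := 1)) i) = (\<Sum>S\<in>Pow J. a S * prod t S)"
      by (rule insert.IH[OF _ insert.prems(2)]) (use insert.prems(1) in simp_all)
    then show ?thesis using that by blast
  qed
  define a where "a S = (if j \<in> S then a1 (S - {j}) - a0 (S - {j}) else a0 S)" for S
  have "F (\<lambda>i. if i \<in> insert j J then t i else b i) = (\<Sum>S\<in>Pow (insert j J). a S * prod t S)"
    if t: "\<forall>i. t i \<ge> 0" for t
  proof -
    define u where "u i = (if i \<in> J then t i else b i)" for i
    have upd: "u(j := s) = (\<lambda>i. if i \<in> J then t i else (b(j := s)) i)" for s
      using insert.hyps by (auto simp: u_def)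
    have "(\<lambda>i. if i \<in> insert j J then t i else b i) = u(j := t j)"
      using insert.hyps by (auto simp: u_def)
    moreover have "F (u(j := t j)) = F (u(j := 0)) + t j * (F (u(j := 1)) - F (u(j := 0)))"
      using t insert.prems(1) by (intro insert.prems(2)) (auto simp: u_def)
    moreover have "F (u(j := 0)) = (\<Sum>S\<in>Pow J. a0 S * prod t S)" "F (u(j := 1)) = (\<Sum>S\<in>Pow J. a1 S * prod t S)"
      unfolding upd using a0 a1 t by auto
    ultimately have "F (\<lambda>i. if i \<in> insert j J then t i else b i)
        = (\<Sum>S\<in>Pow J. a0 S * prod t S) + (\<Sum>S\<in>Pow J. (a1 S - a0 S) * (t j * prod t S))"
      by (simp add: sum_subtractf[symmetric] sum_distrib_left algebra_simps)
    also have "(\<Sum>S\<in>Pow J. a0 S * prod t S) = (\<Sum>S\<in>Pow J. a S * prod t S)"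
      using insert.hyps by (intro sum.cong) (auto simp: a_def)
    also have "(\<Sum>S\<in>Pow J. (a1 S - a0 S) * (t j * prod t S)) = (\<Sum>S\<in>insert j ` Pow J. a S * prod t S)"
    proof (subst sum.reindex)
      show inj: "inj_on (insert j) (Pow J)"
        using insert.hyps by (auto simp: inj_on_def)
      show "(\<Sum>S\<in>Pow J. (a1 S - a0 S) * (t j * prod t S)) = sum ((\<lambda>S. a S * prod t S) \<circ> insert j) (Pow J)"
      proof (intro sum.cong refl)
        fix S assume "S \<in> Pow J"
        then have "j \<notin> S" "finite S" using insert.hyps finite_subset by auto
        then show "(a1 S - a0 S) * (t j * prod t S) = ((\<lambda>S. a S * prod t S) \<circ> insert j) S"
          by (simp add: a_def)
      qed
    qed
    finally show ?thesis
      unfolding Pow_insert using insert.hyps by (subst sum.union_disjoint) auto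
  qed
  then show ?case by blast
qed

text \<open>A function that is affine in each variable is a combination of the monomials \<open>prod t S\<close>. Homogeneity of degree \<open>n\<close> removes
  all of them except those with \<open>card S = n\<close>, and the coefficient of such a monomial is the value at the indicator function of \<open>S\<close>.\<close>

lemma homogeneous_multiaffine_nonneg:
  fixes F :: "('i \<Rightarrow> real) \<Rightarrow> real"
  assumes I: "finite I"
    and aff: "\<And>t j s. j \<in> I \<Longrightarrow> (\<And>i. t i \<ge> 0) \<Longrightarrow> s \<ge> 0 \<Longrightarrow>
        F (t(j := s)) = F (t(j := 0)) + s * (F (t(j := 1)) - F (t(j := 0)))"
    and hom: "\<And>t s. (\<And>i. t i \<ge> 0) \<Longrightarrow> s > 0 \<Longrightarrow> F (\<lambda>i. s * t i) = s ^ n * F t"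
    and vert: "\<And>S. S \<subseteq> I \<Longrightarrow> card S = n \<Longrightarrow> F (indicator S) \<ge> 0"
    and t: "\<And>i. t i \<ge> 0" "\<And>i. i \<notin> I \<Longrightarrow> t i = 0"
  shows "F t \<ge> 0"
proof -
  have "\<exists>a. \<forall>t. (\<forall>i. t i \<ge> 0) \<longrightarrow> F (\<lambda>i. if i \<in> I then t i else 0) = (\<Sum>S\<in>Pow I. a S * prod t S)"
    by (rule multiaffine_expansion[OF I _ aff]) simp_all
  then obtain a where a: "\<And>t. (\<And>i. t i \<ge> 0) \<Longrightarrow> F (\<lambda>i. if i \<in> I then t i else 0) = (\<Sum>S\<in>Pow I. a S * prod t S)"
    by blast
  have F: "F t = (\<Sum>S | S \<subseteq> I \<and> card S = n. a S * prod t S)"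
    if t: "\<And>i. t i \<ge> 0" "\<And>i. i \<notin> I \<Longrightarrow> t i = 0" for t
  proof -
    have eq: "(\<lambda>i. if i \<in> I then s * t i else 0) = (\<lambda>i. s * t i)" for s using t(2) by auto
    \<comment> \<open>For fixed t both sides of the homogeneity equation are polynomials in the scaling factor s; compare the coefficients at s^n.\<close>
    define p where "p = (\<Sum>S\<in>Pow I. monom (a S * prod t S) (card S)) - monom (F t) n"
    have "poly p s = 0" if s: "s > 0" for s
    proof -
      have "s ^ n * F t = F (\<lambda>i. if i \<in> I then s * t i else 0)" unfolding eq using hom t(1) s by simp
      also have "\<dots> = (\<Sum>S\<in>Pow I. a S * prod (\<lambda>i. s * t i) S)" using a[of "\<lambda>i. s * t i"] t(1) s by simp
      also have "\<dots> = (\<Sum>S\<in>Pow I. a S * prod t S * s ^ card S)"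
        by (intro sum.cong) (auto simp: prod.distrib)
      finally show ?thesis by (simp add: p_def poly_sum poly_monom mult.commute)
    qed
    then have "{0<..} \<subseteq> {s. poly p s = 0}" by auto
    then have "p = 0"
      using poly_roots_finite[of p] infinite_Ioi[of "0::real"] finite_subset by blast
    then have "0 = coeff p n" by simp
    also have "\<dots> = (\<Sum>S\<in>Pow I. if card S = n then a S * prod t S else 0) - F t"
      by (simp add: p_def coeff_sum)
    also have "(\<Sum>S\<in>Pow I. if card S = n then a S * prod t S else 0) = (\<Sum>S | S \<subseteq> I \<and> card S = n. a S * prod t S)"
      using I by (simp add: sum.inter_filter[symmetric] Pow_def)
    finally show ?thesis by simp
  qed
  have "a S \<ge> 0" if S: "S \<subseteq> I" "card S = n" for S
  proof -
    have "prod (indicator S) T = (if T = S then 1 else 0 :: real)" if "T \<subseteq> I \<and> card T = n" for T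
    proof -
      have "T = S" if "T \<subseteq> S"
        using that S I \<open>T \<subseteq> I \<and> card T = n\<close> by (metis card_subset_eq finite_subset)
      moreover have "finite T" using that I finite_subset by blast
      ultimately show ?thesis
        by (cases "T \<subseteq> S") (auto simp: indicator_def intro!: prod_zero)
    qed
    then have "F (indicator S) = (\<Sum>T | T \<subseteq> I \<and> card T = n. if T = S then a T else 0)"
      using S by (subst F) (auto simp: indicator_def intro!: sum.cong)
    also have "\<dots> = a S" using S I by simp
    finally show ?thesis using vert[OF S] by simp
  qed
  then have "0 \<le> (\<Sum>S | S \<subseteq> I \<and> card S = n. a S * prod t S)"
    using t(1) by (auto intro!: sum_nonneg mult_nonneg_nonneg prod_nonneg)
  also have "\<dots> = F t" by (rule F[symmetric]) (use t in auto)
  finally show ?thesis .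
qed

definition outer :: "real^'n \<Rightarrow> real^'n^'n" where
  "outer y = (\<chi> i j. y $ i * y $ j)"

lemma outer_scaleR: "outer (c *\<^sub>R y) = c\<^sup>2 *\<^sub>R outer y"
  by (simp add: outer_def vec_eq_iff power2_eq_square)

lemma outer_mult_vec: "outer y *v x = (y \<bullet> x) *\<^sub>R y"
  by (simp add: outer_def vec_eq_iff matrix_vector_mult_def inner_vec_def sum_distrib_left sum_distrib_right mult.commute mult.left_commute)

lemma outer_congruence: "A ** outer y ** transpose A = outer (A *v y)"
proof -
  have "(A ** outer y ** transpose A) *v x = outer (A *v y) *v x" for x
    by (simp add: matrix_vector_mul_assoc[symmetric] outer_mult_vec matrix_vector_mult_scaleR
        dot_lmul_matrix[symmetric] inner_commute)
  then show ?thesis by (simp add: matrix_eq)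
qed

lemma det_scaleR:
  fixes A :: "real^'n^'n"
  shows "det (c *\<^sub>R A) = c ^ CARD('n) * det A"
proof -
  have "c *\<^sub>R A = mat c ** A"
    by (simp add: vec_eq_iff matrix_matrix_mult_def mat_def if_distrib[of "\<lambda>x. x * _"] cong: if_cong)
  moreover have "det (mat c :: real^'n^'n) = c ^ CARD('n)"
    by (subst det_diagonal) (auto simp: mat_def)
  ultimately show ?thesis by (simp add: det_mul)
qed

lemma det_add_outer_axis:
  fixes A :: "real^'n^'n"
  shows "det (A + r *\<^sub>R outer (axis k 1)) = det A + r * det (\<chi> i. if i = k then axis k 1 else A $ i)"
proof -
  have "A + r *\<^sub>R outer (axis k 1) = (\<chi> i. if i = k then A $ i + r *s axis k 1 else A $ i)"
    by (auto simp: vec_eq_iff outer_def axis_def)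
  then have "det (A + r *\<^sub>R outer (axis k 1)) = det (\<chi> i. if i = k then A $ i else A $ i)
      + det (\<chi> i. if i = k then r *s axis k 1 else A $ i)"
    by (simp only: det_row_add)
  then show ?thesis by (simp add: det_row_mul)
qed

lemma matrix_add_mult_distrib:
  fixes A B :: "real^'n^'m" and C :: "real^'k^'n"
  shows "(A + B) ** C = A ** C + B ** C"
  by (simp add: vec_eq_iff matrix_matrix_mult_def sum.distrib distrib_right)

text \<open>A rank-one change of a matrix changes the determinant by an affine function: after a rotation \<open>v\<close> points along a coordinate
  axis, and only one entry of the matrix depends on \<open>s\<close>.\<close>

lemma det_add_outer:
  fixes A :: "real^'n^'n" and v :: "real^'n"
  obtains \<beta> where "\<And>s. det (A + s *\<^sub>R outer v) = det A + s * \<beta>" "A = mat 1 \<Longrightarrow> \<beta> = (norm v)\<^sup>2"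
proof -
  fix k :: 'n
  have "norm (norm v *\<^sub>R axis k (1::real)) = norm v" by simp
  then obtain f where f: "orthogonal_transformation f" "f (norm v *\<^sub>R axis k (1::real)) = v"
    using orthogonal_transformation_exists by metis
  define Q where "Q = matrix f"
  have Q: "orthogonal_matrix Q" using f(1) by (simp add: Q_def orthogonal_transformation_matrix)
  have v: "v = norm v *\<^sub>R (Q *v axis k 1)"
    using f(2) linear_scale[OF orthogonal_transformation_linear[OF f(1)], of "norm v" "axis k 1"]
    by (simp add: Q_def matrix_works orthogonal_transformation_linear[OF f(1)])
  have QQ: "Q ** transpose Q = mat 1" "transpose Q ** Q = mat 1"
    using Q by (auto simp: orthogonal_matrix_def)
  have detQ: "det Q * det (transpose Q) = 1"
    using arg_cong[OF QQ(1), of det] by (simp only: det_mul det_I)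
  define B where "B = transpose Q ** A ** Q"
  define \<beta> where "\<beta> = (norm v)\<^sup>2 * det (\<chi> i. if i = k then axis k 1 else B $ i)"
  have A: "A = Q ** B ** transpose Q"
    unfolding B_def by (metis QQ(1) matrix_mul_assoc matrix_mul_lid matrix_mul_rid)
  have det: "det (Q ** X ** transpose Q) = det X" for X
    using detQ by (simp add: det_mul)
  show thesis
  proof (rule that)
    fix s
    have "A + s *\<^sub>R outer v = Q ** (B + (s * (norm v)\<^sup>2) *\<^sub>R outer (axis k 1)) ** transpose Q"
      by (subst A, subst v)
        (simp add: outer_scaleR outer_congruence[symmetric] matrix_add_ldistrib matrix_add_mult_distrib
          matrix_scalar_ac scalar_matrix_assoc[symmetric])
    then have "det (A + s *\<^sub>R outer v) = det (B + (s * (norm v)\<^sup>2) *\<^sub>R outer (axis k 1))"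
      by (simp only: det)
    also have "\<dots> = det A + s * \<beta>"
      by (simp add: det_add_outer_axis \<beta>_def A det)
    finally show "det (A + s *\<^sub>R outer v) = det A + s * \<beta>" .
  next
    assume "A = mat 1"
    then have "B = mat 1" by (simp add: B_def QQ)
    then have "(\<chi> i. if i = k then axis k 1 else B $ i) = mat 1"
      by (auto simp: vec_eq_iff mat_def axis_def)
    then show "\<beta> = (norm v)\<^sup>2" by (simp add: \<beta>_def)
  qed
qed

text \<open>The zonotope of the coordinate vectors is the unit cube.\<close>

lemma zonotope_axis: "zonotope UNIV (\<lambda>k. axis k 1) = cbox 0 (1 :: real^'n)"
proof -
  have seg: "closed_segment 0 (axis k 1) = (\<lambda>x. x *\<^sub>R axis k 1) ` {0..1::real}" for k :: 'n
    by (auto simp: closed_segment_def)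
  have "x \<in> cbox 0 1 \<longleftrightarrow> x \<in> zonotope UNIV (\<lambda>k. axis k 1)" for x :: "real^'n"
  proof
    assume x: "x \<in> cbox 0 1"
    then have "x $ k \<in> {0..1}" for k by (simp add: mem_box_cart)
    moreover have "x = (\<Sum>k\<in>UNIV. x $ k *\<^sub>R axis k 1)"
      using basis_expansion[of x] by (simp only: scalar_mult_eq_scaleR)
    ultimately show "x \<in> zonotope UNIV (\<lambda>k. axis k 1)"
      unfolding zonotope_def set_sum_alt[OF finite] seg by blast
  next
    assume "x \<in> zonotope UNIV (\<lambda>k. axis k 1)"
    then obtain s where s: "x = sum s UNIV" "\<And>k. s k \<in> closed_segment 0 (axis k 1)"
      unfolding zonotope_def set_sum_alt[OF finite] by blast
    then obtain c where c: "\<And>k. s k = c k *\<^sub>R axis k 1" "\<And>k. c k \<in> {0..1}"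
      unfolding seg image_iff by metis
    have "x $ k = c k" for k
      by (simp add: s(1) c(1) sum_component axis_def if_distrib cong: if_cong)
    then show "x \<in> cbox 0 1" using c(2) by (auto simp: mem_box_cart)
  qed
  then show ?thesis by blast
qed

text \<open>A parallelotope is the image of the unit cube under the matrix \<open>Y\<close> of its edge vectors, and the sum of the outer products is
  \<open>Y Y^T\<close>.\<close>

lemma vol_parallelotope:
  fixes y :: "'n \<Rightarrow> real^'n"
  shows "(vol (zonotope UNIV y))\<^sup>2 = det (\<Sum>k\<in>UNIV. outer (y k))"
proof -
  define Y :: "real^'n^'n" where "Y = (\<chi> i k. y k $ i)"
  have "y = (\<lambda>k. Y *v axis k 1)"
    by (rule ext) (simp add: Y_def vec_eq_iff matrix_vector_mult_basis column_def)
  then have "zonotope UNIV y = (\<lambda>x. Y *v x) ` cbox 0 1"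
    using zonotope_linear_image[where I = UNIV and f = "\<lambda>x. Y *v x" and z = "\<lambda>k. axis k 1"]
    by (simp add: zonotope_axis)
  then have "vol (zonotope UNIV y) = \<bar>det Y\<bar> * vol (cbox 0 (1::real^'n))"
    using measure_linear_image_det(2)[OF matrix_vector_mul_linear, of "cbox 0 1" Y] by simp
  also have "vol (cbox 0 (1::real^'n)) = 1"
    using content_cbox_cart[of 0 "1::real^'n"] by (simp add: interval_ne_empty_cart measure_completion)
  finally have "(vol (zonotope UNIV y))\<^sup>2 = det (Y ** transpose Y)"
    by (simp add: det_mul power2_eq_square)
  also have "Y ** transpose Y = (\<Sum>k\<in>UNIV. outer (y k))"
    by (simp add: vec_eq_iff Y_def matrix_matrix_mult_def transpose_def outer_def sum_component)
  finally show ?thesis .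
qed

lemma vol_parallelotope_card:
  fixes y :: "'i \<Rightarrow> real^'n"
  assumes "finite S" "card S = CARD('n)"
  shows "(vol (zonotope S y))\<^sup>2 = det (\<Sum>i\<in>S. outer (y i))"
proof -
  obtain \<sigma> where \<sigma>: "bij_betw \<sigma> (UNIV :: 'n set) S"
    using finite_same_card_bij[OF finite assms(1)] assms(2) by metis
  have "zonotope S y = zonotope UNIV (\<lambda>k. y (\<sigma> k))"
    unfolding zonotope_def by (rule sum.reindex_bij_betw[OF \<sigma>, symmetric])
  moreover have "(\<Sum>i\<in>S. outer (y i)) = (\<Sum>k\<in>UNIV. outer (y (\<sigma> k)))"
    by (rule sum.reindex_bij_betw[OF \<sigma>, symmetric])
  ultimately show ?thesis by (simp add: vol_parallelotope)
qed

text \<open>As functions of \<open>t\<close> the two sides are affine in each variable, the volume because that of \<open>D + [0, s y]\<close> grows linearly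
  with \<open>s\<close> and the determinant by \<open>det_add_outer\<close>, and they are homogeneous of degree n. It is therefore enough to compare them at indicator
  functions of n-element sets, where they are \<open>W * v\<close> and \<open>v^2\<close> for the volume \<open>v \<le> W\<close> of a parallelotope. This
  replaces the Cauchy--Binet formula and the decomposition of a zonotope into parallelotopes.\<close>

theorem det_le_vol_zonotope:
  fixes y :: "'i \<Rightarrow> real^'n"
  assumes I: "finite I" and W: "W \<ge> 0"
    and S: "\<And>S. S \<subseteq> I \<Longrightarrow> card S = CARD('n) \<Longrightarrow> det (\<Sum>i\<in>S. outer (y i)) \<le> W\<^sup>2"
    and t: "\<And>i. i \<in> I \<Longrightarrow> t i \<ge> 0"
  shows "det (\<Sum>i\<in>I. t i *\<^sub>R outer (y i)) \<le> W * vol (zonotope I (\<lambda>i. t i *\<^sub>R y i))"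
proof -
  define V where "V t = vol (zonotope I (\<lambda>i. t i *\<^sub>R y i))" for t
  define M where "M t = det (\<Sum>i\<in>I. t i *\<^sub>R outer (y i))" for t
  define F where "F t = W * V t - M t" for t
  have affV: "\<exists>\<beta>. \<forall>s\<ge>0. V (t(j := s)) = V (t(j := 0)) + s * \<beta>" if j: "j \<in> I" for t j
  proof -
    let ?D = "zonotope (I - {j}) (\<lambda>i. t i *\<^sub>R y i)"
    have "zonotope I (\<lambda>i. (t(j := s)) i *\<^sub>R y i) = ?D + closed_segment 0 (s *\<^sub>R y j)" for s
    proof -
      have "zonotope I (\<lambda>i. (t(j := s)) i *\<^sub>R y i)
          = zonotope (I - {j}) (\<lambda>i. (t(j := s)) i *\<^sub>R y i) + closed_segment 0 (s *\<^sub>R y j)"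
        unfolding zonotope_def using I j by (subst sum.remove[OF I j]) (simp add: add.commute)
      also have "zonotope (I - {j}) (\<lambda>i. (t(j := s)) i *\<^sub>R y i) = ?D"
        unfolding zonotope_def by (intro sum.cong) auto
      finally show ?thesis .
    qed
    then have "V (t(j := s)) = vol ?D + s * shadow ?D (y j)" if "s \<ge> 0" for s
      using that I by (simp add: V_def vol_plus_scaled_segment convex_zonotope compact_zonotope)
    then show ?thesis by (intro exI[of _ "shadow ?D (y j)"]) simp
  qed
  have affM: "\<exists>\<beta>. \<forall>s\<ge>0. M (t(j := s)) = M (t(j := 0)) + s * \<beta>" if j: "j \<in> I" for t j
  proof -
    let ?A = "\<Sum>i\<in>I - {j}. t i *\<^sub>R outer (y i)"
    have M: "M (t(j := s)) = det (?A + s *\<^sub>R outer (y j))" for s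
    proof -
      have "(\<Sum>i\<in>I - {j}. (t(j := s)) i *\<^sub>R outer (y i)) = ?A" by (intro sum.cong) auto
      then show ?thesis
        unfolding M_def by (subst sum.remove[OF I j]) (simp add: add.commute)
    qed
    obtain \<beta> where \<beta>: "\<And>s. det (?A + s *\<^sub>R outer (y j)) = det ?A + s * \<beta>"
      by (rule det_add_outer[of ?A "y j"]) (rule that)
    show ?thesis unfolding M by (intro exI[of _ \<beta>]) (simp add: \<beta>)
  qed
  define t' where "t' i = (if i \<in> I then t i else 0)" for i
  have "F t' \<ge> 0"
  proof (rule homogeneous_multiaffine_nonneg[OF I, where n = "CARD('n)" and F = F and t = t'])
    show "F (t(j := s)) = F (t(j := 0)) + s * (F (t(j := 1)) - F (t(j := 0)))"
      if j: "j \<in> I" and s: "s \<ge> 0" for t j s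
    proof -
      obtain \<beta> where \<beta>: "\<And>s. s \<ge> 0 \<Longrightarrow> V (t(j := s)) = V (t(j := 0)) + s * \<beta>"
        using affV[OF j, of t] by blast
      obtain \<gamma> where \<gamma>: "\<And>s. s \<ge> 0 \<Longrightarrow> M (t(j := s)) = M (t(j := 0)) + s * \<gamma>"
        using affM[OF j, of t] by blast
      show ?thesis
        unfolding F_def \<beta>[OF s] \<gamma>[OF s] \<beta>[OF zero_le_one] \<gamma>[OF zero_le_one]
        by (simp add: algebra_simps)
    qed
    show "F (\<lambda>i. s * t i) = s ^ CARD('n) * F t" if "s > 0" for t s
    proof -
      have "V (\<lambda>i. s * t i) = s ^ CARD('n) * V t"
        using vol_zonotope_scaleR[OF I, of s "\<lambda>i. t i *\<^sub>R y i"] that by (simp add: V_def)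
      moreover have "M (\<lambda>i. s * t i) = s ^ CARD('n) * M t"
        unfolding M_def by (simp add: scaleR_sum_right[symmetric] scaleR_scaleR[symmetric] det_scaleR del: scaleR_scaleR)
      ultimately show ?thesis by (simp add: F_def right_diff_distrib)
    qed
    show "F (indicator S) \<ge> 0" if S': "S \<subseteq> I" "card S = CARD('n)" for S
    proof -
      have fin: "finite S" using S'(1) I finite_subset by blast
      define v where "v = vol (zonotope S y)"
      have "zonotope I (\<lambda>i. indicator S i *\<^sub>R y i) = zonotope S y"
        unfolding zonotope_def using S'(1) I
        by (intro sum.mono_neutral_cong_right) (auto simp: set_zero indicator_def)
      then have V: "V (indicator S) = v" by (simp add: V_def v_def)
      have "(\<Sum>i\<in>I. indicator S i *\<^sub>R outer (y i)) = (\<Sum>i\<in>S. outer (y i))"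
        using S'(1) I by (intro sum.mono_neutral_cong_right) (auto simp: indicator_def)
      then have M: "M (indicator S) = v\<^sup>2"
        by (simp add: M_def v_def vol_parallelotope_card[OF fin S'(2)])
      have v: "v \<ge> 0" by (simp add: v_def)
      have "v\<^sup>2 \<le> W\<^sup>2" using S[OF S'] vol_parallelotope_card[OF fin S'(2)] by (simp add: v_def)
      then have "v \<le> W" using W by (rule power2_le_imp_le)
      then have "v\<^sup>2 \<le> W * v" unfolding power2_eq_square using v by (rule mult_right_mono)
      then show ?thesis by (simp add: F_def V M)
    qed
  qed (use t in \<open>auto simp: t'_def\<close>)
  moreover have "V t' = V t" "M t' = M t"
    unfolding V_def M_def zonotope_def t'_def by (simp_all cong: sum.cong)
  ultimately show ?thesis by (simp add: F_def V_def M_def)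
qed

section \<open>The smallest ellipsoid around the polar projection body\<close>

text \<open>Lower semicontinuity of the shadow: if \<open>z\<close> is close to \<open>w\<close>, then \<open>C + [0, w]\<close> lies in a slight dilate of
  \<open>C + [0, z]\<close>.\<close>

lemma closed_shadow_le:
  fixes C :: "(real^'n) set"
  assumes C: "convex C" "compact C" "0 \<in> interior C"
  shows "closed {y. shadow C y \<le> c}"
  unfolding closed_sequential_limits
proof clarify
  fix z w assume "\<forall>m. z m \<in> {y. shadow C y \<le> c}" and lim: "z \<longlonglongrightarrow> w"
  then have z: "shadow C (z m) \<le> c" for m by simp
  obtain k where k: "k > 0" "cball 0 1 \<subseteq> (\<lambda>x. k *\<^sub>R x) ` C"
    using bounded_subset_dilate[OF bounded_cball C(3)] .
  have bound: "vol (C + closed_segment 0 w) \<le> (1 + k * norm (w - z m)) ^ CARD('n) * (vol C + c)" for m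
  proof -
    let ?d = "norm (w - z m)"
    let ?D = "C + closed_segment 0 (z m)"
    have D: "convex ?D" "compact ?D" by (auto intro: convex_set_plus compact_set_plus C)
    have "C + closed_segment 0 w \<subseteq> ?D + (\<lambda>x. ?d *\<^sub>R x) ` cball 0 1"
    proof
      fix x assume "x \<in> C + closed_segment 0 w"
      then obtain a t where a: "a \<in> C" "0 \<le> t" "t \<le> 1" "x = a + t *\<^sub>R w"
        by (auto simp: set_plus_def in_segment)
      have "t *\<^sub>R (w - z m) \<in> cball 0 ?d"
        using a by (simp add: mult_left_le_one_le)
      also have "cball 0 ?d = (\<lambda>x. ?d *\<^sub>R x) ` cball (0::real^'n) 1"
      proof (cases "?d = 0")
        case False
        then have "(\<lambda>x. ?d *\<^sub>R x) ` cball (0::real^'n) 1 = cball 0 ?d"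
          using cball_scale[of ?d 0 1] by simp
        then show ?thesis by (rule sym)
      qed (auto intro: image_eqI[of _ _ 0])
      finally have "(a + t *\<^sub>R z m) + t *\<^sub>R (w - z m) \<in> ?D + (\<lambda>x. ?d *\<^sub>R x) ` cball 0 1"
        using a by (intro set_plus_intro) (auto simp: in_segment)
      then show "x \<in> ?D + (\<lambda>x. ?d *\<^sub>R x) ` cball 0 1"
        using a by (simp add: algebra_simps)
    qed
    also have "\<dots> \<subseteq> (\<lambda>x. (1 + k * ?d) *\<^sub>R x) ` ?D"
    proof (rule plus_scaled_subset_dilate[OF D(1)])
      have "C \<subseteq> ?D" using set_zero_plus2[of "closed_segment 0 (z m)" C] by (simp add: add.commute)
      then show "cball 0 1 \<subseteq> (\<lambda>x. k *\<^sub>R x) ` ?D" using k(2) by blast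
    qed (use k(1) in auto)
    finally have "vol (C + closed_segment 0 w) \<le> vol ((\<lambda>x. (1 + k * ?d) *\<^sub>R x) ` ?D)"
      using D by (intro measure_mono_fmeasurable fmeasurableD lmeasurable_compact compact_scaling compact_set_plus C) auto
    also have "\<dots> = (1 + k * ?d) ^ CARD('n) * vol ?D"
      using measure_lebesgue_affine[of "1 + k * ?d" 0 ?D] k(1) by (simp add: add_nonneg_nonneg)
    also have "\<dots> \<le> (1 + k * ?d) ^ CARD('n) * (vol C + c)"
      using z[of m] k(1) by (intro mult_left_mono) (auto simp: shadow_def)
    finally show ?thesis .
  qed
  have "(\<lambda>m. (1 + k * norm (w - z m)) ^ CARD('n) * (vol C + c)) \<longlonglongrightarrow> (1 + k * norm (w - w)) ^ CARD('n) * (vol C + c)"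
    by (intro tendsto_intros lim)
  then have "vol (C + closed_segment 0 w) \<le> vol C + c"
    using bound by (intro LIMSEQ_le_const[of _ "vol C + c"]) auto
  then show "shadow C w \<le> c" by (simp add: shadow_def)
qed

text \<open>A segment longer than the diameter of \<open>C\<close> moves \<open>C\<close> to a disjoint copy, so the shadow in its direction is at least
  the volume of \<open>C\<close>.\<close>

lemma shadow_ge_norm:
  fixes C :: "(real^'n) set"
  assumes C: "convex C" "compact C" "interior C \<noteq> {}"
  obtains e where "e > 0" "\<And>y. shadow C y \<ge> e * norm y"
proof -
  obtain r where r: "r > 0" "C \<subseteq> ball 0 r" using compact_imp_bounded[OF C(2)] bounded_subset_ballD by blast
  have "shadow C y \<ge> vol C / (2 * r) * norm y" for y
  proof (cases "y = 0")
    case False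
    define z where "z = (2 * r / norm y) *\<^sub>R y"
    have nz: "norm z = 2 * r" using False r by (simp add: z_def)
    have "C \<inter> (+) z ` C = {}"
    proof (rule ccontr)
      assume "C \<inter> (+) z ` C \<noteq> {}"
      then obtain a b where "a \<in> C" "b \<in> C" "a = z + b" by blast
      then have "norm a < r" "norm b < r" "z = a - b" using r by auto
      then show False using nz norm_triangle_ineq4[of a b] by simp
    qed
    then have "vol C + vol ((+) z ` C) = vol (C \<union> (+) z ` C)"
      using C by (intro vol_Un_disjoint[symmetric] lmeasurable_compact compact_translation) auto
    also have "\<dots> \<le> vol (C + closed_segment 0 z)"
    proof (intro measure_mono_fmeasurable)
      show "C \<union> (+) z ` C \<subseteq> C + closed_segment 0 z"
      proof (intro Un_least subsetI)
        fix x assume "x \<in> C"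
        then have "x + 0 \<in> C + closed_segment 0 z" by (intro set_plus_intro) auto
        then show "x \<in> C + closed_segment 0 z" by simp
      next
        fix x assume "x \<in> (+) z ` C"
        then obtain a where "a \<in> C" "x = a + z" by (auto simp: add.commute)
        then show "x \<in> C + closed_segment 0 z" by (simp add: set_plus_intro)
      qed
      show "C \<union> (+) z ` C \<in> sets lebesgue"
        using C by (intro sets.Un fmeasurableD lmeasurable_compact compact_translation) auto
      show "C + closed_segment 0 z \<in> lmeasurable"
        using C by (intro lmeasurable_compact compact_set_plus) auto
    qed
    finally have "vol C \<le> shadow C z" by (simp add: shadow_def measure_translation)
    also have "\<dots> = 2 * r / norm y * shadow C y"
      unfolding z_def using r by (intro shadow_scaleR C) auto
    finally show ?thesis using r False by (simp add: field_simps)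
  qed simp
  moreover have "vol C / (2 * r) > 0" using vol_pos_convex[OF C] r by simp
  ultimately show ?thesis using that by blast
qed

lemma continuous_on_det:
  fixes f :: "'a::topological_space \<Rightarrow> real^'n^'n"
  assumes "continuous_on S f"
  shows "continuous_on S (\<lambda>x. det (f x))"
  unfolding det_def by (intro continuous_intros assms)

lemma continuous_on_outer: "continuous_on S outer"
  unfolding outer_def by (intro continuous_intros)

text \<open>Gram--Schmidt orthogonalisation for the inner product \<open>x \<bullet> (M *v y)\<close>; the rows of \<open>F\<close> are the resulting
  orthonormal basis.\<close>

lemma pos_def_congruent_identity:
  fixes M :: "real^'n^'n"
  assumes sym: "transpose M = M" and pos: "\<And>x. x \<noteq> 0 \<Longrightarrow> x \<bullet> (M *v x) > 0"
  obtains F :: "real^'n^'n" where "F ** M ** transpose F = mat 1"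
proof -
  have comm: "x \<bullet> (M *v y) = y \<bullet> (M *v x)" for x y
    by (metis dot_lmul_matrix inner_commute sym transpose_matrix_vector)
  have "\<exists>b. \<forall>k\<in>J. \<forall>l\<in>J. b k \<bullet> (M *v b l) = (if k = l then 1 else 0)" for J :: "'n set"
    using finite[of J]
  proof (induction J rule: finite_induct)
    case (insert j J)
    then obtain b where b: "\<And>k l. k \<in> J \<Longrightarrow> l \<in> J \<Longrightarrow> b k \<bullet> (M *v b l) = (if k = l then 1 else 0)" by blast
    have "dim ((\<lambda>k. M *v b k) ` J) \<le> card J"
      using dim_le_card'[of "(\<lambda>k. M *v b k) ` J"] card_image_le[of J] insert.hyps(1) by (meson finite_imageI le_trans)
    also have "card J < CARD('n)"
      using insert.hyps(2) by (intro psubset_card_mono) auto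
    finally have "dim ((\<lambda>k. M *v b k) ` J) < DIM(real^'n)" by simp
    then obtain x where x: "x \<noteq> 0" "\<And>y. y \<in> span ((\<lambda>k. M *v b k) ` J) \<Longrightarrow> orthogonal x y"
      by (rule orthogonal_to_subspace_exists) (rule that)
    have xb: "x \<bullet> (M *v b k) = 0" if "k \<in> J" for k
      using x(2) that by (simp add: orthogonal_def span_base)
    define q where "q = x \<bullet> (M *v x)"
    have q: "q > 0" using pos[OF x(1)] by (simp add: q_def)
    define b' where "b' = b(j := (1 / sqrt q) *\<^sub>R x)"
    have "b' k \<bullet> (M *v b' l) = (if k = l then 1 else 0)" if kl: "k \<in> insert j J" "l \<in> insert j J" for k l
    proof -
      have "b' j \<bullet> (M *v b' j) = (1 / sqrt q) * ((1 / sqrt q) * q)"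
        by (simp add: b'_def matrix_vector_mult_scaleR q_def)
      also have "\<dots> = 1" using q by (simp add: field_simps)
      finally have jj: "b' j \<bullet> (M *v b' j) = 1" .
      have ji: "b' j \<bullet> (M *v b' i) = 0" if "i \<in> J" for i
      proof -
        have "i \<noteq> j" using that insert.hyps(2) by blast
        then show ?thesis using xb[OF that] by (simp add: b'_def)
      qed
      have ii: "b' i = b i" if "i \<in> J" for i
        using that insert.hyps(2) by (auto simp: b'_def)
      consider "k = j" "l = j" | "k = j" "l \<in> J" | "k \<in> J" "l = j" | "k \<in> J" "l \<in> J"
        using kl by blast
      then show ?thesis
      proof cases
        case 1
        then show ?thesis by (simp add: jj)
      next
        case 2
        then show ?thesis using ji insert.hyps(2) by auto
      next
        case 3
        then show ?thesis using ji[of k] insert.hyps(2) comm[of "b' k" "b' j"] by auto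
      next
        case 4
        then show ?thesis using b ii by simp
      qed
    qed
    then show ?case by blast
  qed simp
  from this[of UNIV] obtain b :: "'n \<Rightarrow> real^'n"
    where b: "\<And>k l. b k \<bullet> (M *v b l) = (if k = l then 1 else 0)" by blast
  define F :: "real^'n^'n" where "F = (\<chi> k. b k)"
  have "(F ** (M ** transpose F)) $ k $ l = b k \<bullet> (M *v b l)" for k l
    by (simp add: F_def matrix_matrix_mult_def transpose_def matrix_vector_mult_def inner_vec_def)
  then have "F ** M ** transpose F = mat 1"
    by (simp add: vec_eq_iff mat_def b matrix_mul_assoc)
  then show ?thesis by (rule that)
qed

lemma nonsingular_sum_outer_pos_def:
  fixes y :: "'i \<Rightarrow> real^'n"
  defines "M \<equiv> \<lambda>I u. \<Sum>i\<in>I. u i *\<^sub>R outer (y i)"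
  assumes I: "finite I" and u: "\<And>i. i \<in> I \<Longrightarrow> u i \<ge> 0" and det: "det (M I u) \<noteq> 0"
  shows "transpose (M I u) = M I u" "x \<noteq> 0 \<Longrightarrow> x \<bullet> (M I u *v x) > 0"
proof -
  show "transpose (M I u) = M I u"
    by (simp add: M_def transpose_def vec_eq_iff outer_def sum_component mult.commute)
  have Mv: "M I u *v x = (\<Sum>i\<in>I. (u i * (y i \<bullet> x)) *\<^sub>R y i)" for x
    unfolding M_def using I
    by (induction I rule: finite_induct)
      (auto simp: matrix_vector_mult_add_rdistrib scaleR_matrix_vector_assoc[symmetric] outer_mult_vec)
  assume x: "x \<noteq> 0"
  have eq: "x \<bullet> (M I u *v x) = (\<Sum>i\<in>I. u i * (y i \<bullet> x)\<^sup>2)"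
    unfolding Mv inner_sum_right by (intro sum.cong) (auto simp: inner_commute power2_eq_square)
  have nonneg: "u i * (y i \<bullet> x)\<^sup>2 \<ge> 0" if "i \<in> I" for i using u that by simp
  have "x \<bullet> (M I u *v x) \<noteq> 0"
  proof
    assume "x \<bullet> (M I u *v x) = 0"
    then have "u i * (y i \<bullet> x) = 0" if "i \<in> I" for i
      using sum_nonneg_eq_0_iff[OF I, of "\<lambda>i. u i * (y i \<bullet> x)\<^sup>2"] nonneg that by (auto simp: eq)
    then have "M I u *v x = 0" unfolding Mv by (simp add: sum.neutral)
    then have "det (M I u) = 0"
      using x by (metis invertible_det_nz invertible_left_inverse matrix_left_invertible_ker)
    then show False using det by simp
  qed
  then show "x \<bullet> (M I u *v x) > 0"
    using sum_nonneg[of I "\<lambda>i. u i * (y i \<bullet> x)\<^sup>2"] nonneg unfolding eq by force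
qed

lemma average_in_convex_hull:
  assumes "finite S" "card S = m" "m > 0" "\<And>i. i \<in> S \<Longrightarrow> g i \<in> A"
  shows "(1 / m) *\<^sub>R (\<Sum>i\<in>S. g i) \<in> convex hull A"
proof -
  have "(\<Sum>i\<in>S. (1 / m) *\<^sub>R g i) \<in> convex hull A"
    using assms by (intro convex_sum) (auto simp: hull_inc)
  then show ?thesis by (simp add: scaleR_sum_right)
qed

text \<open>Maximise the determinant over the convex hull \<open>H\<close> of the matrices \<open>outer y\<close> with \<open>y\<close> in \<open>K\<close>. For \<open>x\<close> in \<open>K\<close> the segment
  from the maximum \<open>M\<close> to \<open>outer x\<close> stays in \<open>H\<close>, and in the coordinates given by \<open>F\<close> the determinant along it is
  \<open>(1 - e)^n + e (1 - e)^(n - 1) |F x|^2\<close>, with derivative \<open>|F x|^2 - n\<close> at \<open>e = 0\<close>. This is the theorem of Kiefer and Wolfowitz: \<open>F\<close> maps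
  the smallest centred ellipsoid around \<open>K\<close> to a ball. The assumption on the axes makes the maximum positive. The index set
  consists of the matrices themselves, and \<open>y\<close> chooses a vector for each of them.\<close>

theorem optimal_design:
  fixes K :: "(real^'n) set"
  assumes K: "compact K" and axes: "\<And>k. \<exists>c\<noteq>0. c *\<^sub>R axis k 1 \<in> K"
  obtains I :: "(real^'n^'n) set" and u y and F :: "real^'n^'n" where
    "finite I" "\<And>i. i \<in> I \<Longrightarrow> u i \<ge> 0" "sum u I = 1" "\<And>i. i \<in> I \<Longrightarrow> y i \<in> K"
    "\<And>S. S \<subseteq> I \<Longrightarrow> card S = CARD('n) \<Longrightarrow>
       det (\<Sum>i\<in>S. outer (y i)) \<le> real CARD('n) ^ CARD('n) * det (\<Sum>i\<in>I. u i *\<^sub>R outer (y i))"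
    "F ** (\<Sum>i\<in>I. u i *\<^sub>R outer (y i)) ** transpose F = mat 1"
    "\<And>x. x \<in> K \<Longrightarrow> (norm (F *v x))\<^sup>2 \<le> real CARD('n)"
proof -
  let ?n = "CARD('n)"
  define H where "H = convex hull (outer ` K)"
  have "compact H"
    unfolding H_def by (intro compact_convex_hull compact_continuous_image continuous_on_outer K)
  have n: "real ?n > 0" by simp
  obtain c where c: "\<And>k. c k \<noteq> 0" "\<And>k. c k *\<^sub>R axis k 1 \<in> K" using axes by metis
  define D where "D = (1 / ?n) *\<^sub>R (\<Sum>k\<in>UNIV. outer (c k *\<^sub>R axis k 1))"
  have "D \<in> H" unfolding D_def H_def by (intro average_in_convex_hull) (auto simp: c)
  have "det D > 0"
  proof -
    have "outer (c k *\<^sub>R axis k 1) = (\<chi> i j. if i = k \<and> j = k then (c k)\<^sup>2 else 0)" for k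
      by (simp add: vec_eq_iff outer_def axis_def power2_eq_square)
    then have "(\<Sum>k\<in>UNIV. outer (c k *\<^sub>R axis k 1)) = (\<chi> i j. if i = j then (c i)\<^sup>2 else 0)"
      by (auto simp: vec_eq_iff sum_component intro!: sum.neutral)
    moreover have "det (\<chi> i j. if i = j then (c i)\<^sup>2 else 0) = (\<Prod>i\<in>UNIV. (c i)\<^sup>2)"
      by (subst det_diagonal) auto
    ultimately show ?thesis
      unfolding D_def det_scaleR using c(1) by (simp add: prod_pos)
  qed
  obtain M where M: "M \<in> H" "\<And>A. A \<in> H \<Longrightarrow> det A \<le> det M"
    using continuous_attains_sup[OF \<open>compact H\<close> _ continuous_on_det[OF continuous_on_id]] \<open>D \<in> H\<close> by auto
  have detM: "det M > 0" using M(2)[OF \<open>D \<in> H\<close>] \<open>det D > 0\<close> by simp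
  obtain I u where I: "finite I" "I \<subseteq> outer ` K" "\<And>i. i \<in> I \<Longrightarrow> u i \<ge> 0" "sum u I = 1" "(\<Sum>i\<in>I. u i *\<^sub>R i) = M"
    using M(1) unfolding H_def convex_hull_explicit by auto
  define y where "y = inv_into K outer"
  have y: "y i \<in> K" "outer (y i) = i" if "i \<in> I" for i
    using I(2) that by (auto simp: y_def inv_into_into f_inv_into_f)
  have My: "(\<Sum>i\<in>I. u i *\<^sub>R outer (y i)) = M"
    unfolding I(5)[symmetric] using y by (intro sum.cong) auto
  obtain F :: "real^'n^'n" where F: "F ** M ** transpose F = mat 1"
  proof (rule pos_def_congruent_identity[of M])
    have "det M \<noteq> 0" using detM by simp
    then show "transpose M = M" "x \<noteq> 0 \<Longrightarrow> x \<bullet> (M *v x) > 0" for x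
      using nonsingular_sum_outer_pos_def[where y = y and u = u and I = I, unfolded My, OF I(1) I(3)] by blast+
  qed blast
  have detF: "det F * det M * det F = 1"
    using arg_cong[OF F, of det] by (simp add: det_mul)
  show thesis
  proof (rule that[of I u y F, unfolded My])
    fix S assume S: "S \<subseteq> I" "card S = ?n"
    have "(1 / ?n) *\<^sub>R (\<Sum>i\<in>S. outer (y i)) \<in> H"
      unfolding H_def using S y I(1) by (intro average_in_convex_hull) (auto intro: finite_subset)
    then have "(1 / ?n) ^ ?n * det (\<Sum>i\<in>S. outer (y i)) \<le> det M"
      using M(2) by (simp flip: det_scaleR)
    then show "det (\<Sum>i\<in>S. outer (y i)) \<le> real ?n ^ ?n * det M"
      using n by (simp add: power_divide field_simps)
  next
    fix x assume x: "x \<in> K"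
    define q where "q = (norm (F *v x))\<^sup>2"
    \<comment> \<open>A quantitative form of the statement that the derivative at e = 0 is at most 0.\<close>
    have *: "q - ?n \<le> e * ((?n - 1) * (q - 1))" if e: "0 < e" "e < 1" for e
    proof -
      have "(1 - e) *\<^sub>R M + e *\<^sub>R outer x \<in> H"
        using M(1) x e unfolding H_def by (intro convexD[OF convex_convex_hull]) (auto intro: hull_inc)
      then have "det ((1 - e) *\<^sub>R M + e *\<^sub>R outer x) \<le> det M" by (rule M(2))
      then have "det F * det ((1 - e) *\<^sub>R M + e *\<^sub>R outer x) * det F \<le> 1"
        using detF mult_left_mono[OF _ zero_le_square[of "det F"], of "det ((1 - e) *\<^sub>R M + e *\<^sub>R outer x)" "det M"]
        by (simp add: algebra_simps)
      moreover have "det F * det ((1 - e) *\<^sub>R M + e *\<^sub>R outer x) * det F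
          = det (F ** ((1 - e) *\<^sub>R M + e *\<^sub>R outer x) ** transpose F)"
        by (simp add: det_mul)
      moreover have "F ** ((1 - e) *\<^sub>R M + e *\<^sub>R outer x) ** transpose F
          = (1 - e) *\<^sub>R (mat 1 + (e / (1 - e)) *\<^sub>R outer (F *v x))"
        using e by (simp add: matrix_add_ldistrib matrix_add_mult_distrib matrix_scalar_ac scalar_matrix_assoc[symmetric]
            F outer_congruence scaleR_add_right)
      moreover have "det (mat 1 + (e / (1 - e)) *\<^sub>R outer (F *v x)) = 1 + e / (1 - e) * q"
        by (rule det_add_outer[of "mat 1" "F *v x"]) (simp add: q_def)
      ultimately have "(1 - e) ^ ?n * (1 + e / (1 - e) * q) \<le> 1"
        by (simp add: det_scaleR)
      moreover have "(1 - e) ^ ?n = (1 - e) ^ (?n - 1) * (1 - e)"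
        by (metis power_minus_mult zero_less_card_finite)
      ultimately have "(1 - e) ^ (?n - 1) * ((1 - e) * (1 + e / (1 - e) * q)) \<le> 1"
        by (simp only: mult.assoc)
      moreover have "(1 - e) * (1 + e / (1 - e) * q) = 1 - e + e * q"
        using e by (simp add: distrib_left)
      ultimately have 1: "(1 - e) ^ (?n - 1) * (1 - e + e * q) \<le> 1" by (simp only:)
      have "1 + real (?n - 1) * (- e) \<le> (1 + - e) ^ (?n - 1)"
        using e by (intro Bernoulli_inequality) simp
      moreover have "0 \<le> 1 - e + e * q" using e by (simp add: q_def)
      ultimately have "(1 - (?n - 1) * e) * (1 - e + e * q) \<le> (1 - e) ^ (?n - 1) * (1 - e + e * q)"
        by (intro mult_right_mono) (auto simp: of_nat_diff algebra_simps)
      with 1 have "(1 - (?n - 1) * e) * (1 - e + e * q) \<le> 1" by simp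
      then have "e * (q - ?n) \<le> e * (e * ((?n - 1) * (q - 1)))"
        by (simp add: algebra_simps)
      then show ?thesis using e by simp
    qed
    have "q - ?n \<le> 0"
    proof (rule tendsto_lowerbound)
      show "((\<lambda>e. e * ((?n - 1) * (q - 1))) \<longlongrightarrow> 0) (at_right 0)"
        by (auto intro!: tendsto_eq_intros)
      show "\<forall>\<^sub>F e in at_right 0. q - ?n \<le> e * ((?n - 1) * (q - 1))"
        using eventually_at_right_real[of 0 1, simplified] by eventually_elim (use * in auto)
    qed simp
    then show "(norm (F *v x))\<^sup>2 \<le> real ?n" by (simp add: q_def)
  qed (use I y F in auto)
qed

section \<open>Affine images with large shadows\<close>

text \<open>The body is translated so that 0 is an interior point, the position in which \<open>closed_shadow_le\<close> shows
  that the polar projection body is closed. In the proof, \<open>d\<close> is the factor by which \<open>F\<close> changes volumes, \<open>v\<close> is the volume of the body and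
  \<open>s = n^(n/2)\<close>; everything rests on the inequality \<open>s * v^(n-1) \<le> d\<close>, the bound for \<open>|det F|\<close> described at the
  beginning.\<close>

theorem theorem1:
  fixes C :: "(real ^ 'n) set"
  assumes "convex_body C"
  shows "\<exists>T :: real ^ 'n \<Rightarrow> real ^ 'n.
    affine_map T \<and> measure lebesgue (T ` C) \<noteq> 0 \<and>
    (\<forall>\<theta> :: real ^ 'n. norm \<theta> = 1 \<longrightarrow>
       measure (subspace_lborel (perp \<theta>)) (proj_perp \<theta> ` (T ` C))
         \<ge> measure lebesgue (T ` C) powr ((real CARD('n) - 1) / real CARD('n)))"
proof -
  let ?n = "CARD('n)"
  have n: "?n > 0" by simp
  obtain x0 where x0: "x0 \<in> interior C" using assms unfolding convex_body_def by blast
  define D where "D = (+) (- x0) ` C"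
  have C: "convex C" "compact C" using assms by (simp_all add: convex_body_def)
  have D: "convex D" "compact D"
    unfolding D_def by (rule convex_translation[OF C(1)], rule compact_translation[OF C(2)])
  have D0: "0 \<in> interior D"
    unfolding D_def interior_translation using x0 by (intro image_eqI[of _ _ x0]) auto
  then have D': "interior D \<noteq> {}" by blast
  define v where "v = vol D"
  have v: "v > 0" unfolding v_def by (rule vol_pos_convex[OF D D'])
  define K where "K = {y. shadow D y \<le> 1}"
  obtain e where e: "e > 0" "\<And>y. shadow D y \<ge> e * norm y"
    by (rule shadow_ge_norm[OF D D']) blast
  have "compact K"
  proof (intro compact_eq_bounded_closed[THEN iffD2] conjI)
    have "norm y \<le> 1 / e" if "y \<in> K" for y
      using e(2)[of y] e(1) that by (simp add: K_def field_simps)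
    then show "bounded K" by (rule boundedI)
    show "closed K" unfolding K_def by (rule closed_shadow_le[OF D D0])
  qed
  moreover have "\<exists>c\<noteq>0. c *\<^sub>R axis k 1 \<in> K" for k
  proof -
    define s where "s = shadow D (axis k 1)"
    have s: "s \<ge> 0" unfolding s_def by (rule shadow_nonneg[OF D])
    then have "shadow D ((1 / (1 + s)) *\<^sub>R axis k 1) = (1 / (1 + s)) * s"
      unfolding s_def by (intro shadow_scaleR D) simp
    also have "\<dots> \<le> 1" using s by (simp add: field_simps)
    finally show ?thesis using s by (intro exI[of _ "1 / (1 + s)"]) (auto simp: K_def)
  qed
  ultimately obtain I :: "(real^'n^'n) set" and u y and F :: "real^'n^'n" where I: "finite I"
    and u: "\<And>i. i \<in> I \<Longrightarrow> u i \<ge> 0" "sum u I = 1" and y: "\<And>i. i \<in> I \<Longrightarrow> y i \<in> K"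
    and S: "\<And>S. S \<subseteq> I \<Longrightarrow> card S = ?n \<Longrightarrow>
       det (\<Sum>i\<in>S. outer (y i)) \<le> real ?n ^ ?n * det (\<Sum>i\<in>I. u i *\<^sub>R outer (y i))"
    and F: "F ** (\<Sum>i\<in>I. u i *\<^sub>R outer (y i)) ** transpose F = mat 1"
    and FK: "\<And>x. x \<in> K \<Longrightarrow> (norm (F *v x))\<^sup>2 \<le> real ?n"
    by (rule optimal_design) blast
  define m where "m = det (\<Sum>i\<in>I. u i *\<^sub>R outer (y i))"
  define Z where "Z = vol (zonotope I (\<lambda>i. u i *\<^sub>R y i))"
  define d where "d = \<bar>det F\<bar>"
  have "det F * m * det F = 1"
    using arg_cong[OF F, of det] by (simp add: det_mul m_def)
  then have dm: "d\<^sup>2 * m = 1" by (simp add: d_def power2_eq_square algebra_simps)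
  then have d: "d > 0" by (auto simp: d_def)
  have m: "m = 1 / d\<^sup>2" using dm d by (simp add: field_simps)
  define s where "s = sqrt ?n ^ ?n"
  have s: "s > 0" "s\<^sup>2 = real ?n ^ ?n"
    by (simp_all add: s_def power_mult[symmetric] mult.commute power2_eq_square flip: power_mult_distrib)
  have "m \<le> (s / d) * Z"
    unfolding m_def Z_def
  proof (rule det_le_vol_zonotope[OF I _ _ u(1)])
    show "det (\<Sum>i\<in>S. outer (y i)) \<le> (s / d)\<^sup>2" if "S \<subseteq> I" "card S = ?n" for S
      using S[OF that] by (simp add: power_divide s(2) m[unfolded m_def])
  qed (use s d in auto)
  then have "1 / d \<le> s * Z"
    using d by (simp add: m power2_eq_square field_simps)
  moreover have "s\<^sup>2 * v ^ (?n - 1) * Z \<le> 1"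
  proof -
    have "s\<^sup>2 * v ^ (?n - 1) * Z \<le> (\<Sum>i\<in>I. shadow D (u i *\<^sub>R y i)) ^ ?n"
      unfolding s(2) v_def Z_def by (rule minkowski_first_inequality_zonotope[OF I D D'])
    also have "(\<Sum>i\<in>I. shadow D (u i *\<^sub>R y i)) = (\<Sum>i\<in>I. u i * shadow D (y i))"
      by (intro sum.cong shadow_scaleR D u) auto
    also have "\<dots> ^ ?n \<le> 1"
    proof (rule power_le_one)
      show "0 \<le> (\<Sum>i\<in>I. u i * shadow D (y i))"
        by (intro sum_nonneg mult_nonneg_nonneg u shadow_nonneg D)
      have "(\<Sum>i\<in>I. u i * shadow D (y i)) \<le> (\<Sum>i\<in>I. u i * 1)"
        using y by (intro sum_mono mult_left_mono u) (auto simp: K_def)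
      then show "(\<Sum>i\<in>I. u i * shadow D (y i)) \<le> 1" using u(2) by simp
    qed
    finally show ?thesis .
  qed
  ultimately have key: "s * v ^ (?n - 1) \<le> d"
  proof -
    assume Z: "1 / d \<le> s * Z" "s\<^sup>2 * v ^ (?n - 1) * Z \<le> 1"
    have "s * v ^ (?n - 1) * (1 / d) \<le> s * v ^ (?n - 1) * (s * Z)"
      using Z(1) s v by (intro mult_left_mono) auto
    also have "\<dots> \<le> 1" using Z(2) by (simp add: power2_eq_square algebra_simps)
    finally show ?thesis using d by (simp add: field_simps)
  qed
  define f where "f x = F *v x" for x
  have f: "linear f" "\<bar>det (matrix f)\<bar> = d"
    unfolding f_def by (simp_all add: d_def)
  have E: "convex (f ` D)" "compact (f ` D)"
    using D f(1) by (auto intro!: convex_linear_image compact_continuous_image linear_continuous_on simp: linear_linear)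
  have vol: "vol (f ` D) = d * v"
    using measure_linear_image_det(2)[OF f(1) lmeasurable_compact[OF D(2)]] f(2) by (simp add: v_def)
  have lower: "(d * v) powr ((real ?n - 1) / real ?n) \<le> measure (subspace_lborel (perp \<theta>)) (proj_perp \<theta> ` (f ` D))"
    if \<theta>: "norm \<theta> = 1" for \<theta>
  proof -
    have "det F \<noteq> 0" using d by (auto simp: d_def)
    then obtain G where "F ** G = mat 1" using invertible_det_nz invertible_right_inverse by blast
    then have G: "f (G *v \<theta>) = \<theta>" by (simp add: f_def matrix_vector_mul_assoc)
    define h where "h = shadow D (G *v \<theta>)"
    have "G *v \<theta> \<noteq> 0" using G \<theta> linear_0[OF f(1)] by auto
    then have "0 < e * norm (G *v \<theta>)" using e(1) by simp
    also have "\<dots> \<le> h" unfolding h_def by (rule e(2))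
    finally have h: "h > 0" .
    have "shadow D ((1 / h) *\<^sub>R (G *v \<theta>)) = (1 / h) * h"
      unfolding h_def using h by (intro shadow_scaleR D) (simp add: h_def)
    then have "(1 / h) *\<^sub>R (G *v \<theta>) \<in> K" using h by (simp add: K_def)
    then have "(norm (f ((1 / h) *\<^sub>R (G *v \<theta>))))\<^sup>2 \<le> ?n" unfolding f_def by (rule FK)
    then have "(1 / h)\<^sup>2 \<le> ?n" using h by (simp add: linear_scale[OF f(1)] G \<theta>)
    then have "1 / h \<le> sqrt ?n" by (rule real_le_rsqrt)
    then have h': "1 / sqrt ?n \<le> h" using h by (simp add: field_simps)
    have "((d * v) powr ((real ?n - 1) / real ?n)) ^ ?n = (d * v) ^ (?n - 1)"
    proof -
      have "((d * v) powr ((real ?n - 1) / real ?n)) ^ ?n = (d * v) powr (real ?n - 1)"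
        using d v by (simp add: powr_powr flip: powr_realpow)
      also have "\<dots> = (d * v) ^ (?n - 1)"
      proof -
        have "real (?n - 1) = real ?n - 1" using n by (simp add: of_nat_diff Suc_leI)
        moreover have "(d * v) powr real (?n - 1) = (d * v) ^ (?n - 1)"
          using d v by (intro powr_realpow) simp
        ultimately show ?thesis by metis
      qed
      finally show ?thesis .
    qed
    also have "\<dots> = d ^ (?n - 1) * v ^ (?n - 1)" by (rule power_mult_distrib)
    also have "\<dots> \<le> d ^ (?n - 1) * (d / s)"
      using key d s by (intro mult_left_mono) (auto simp: field_simps)
    also have "\<dots> = (d * (1 / sqrt ?n)) ^ ?n"
      using power_minus_mult[OF n, of d] by (simp add: s_def power_divide)
    finally have "(d * v) powr ((real ?n - 1) / real ?n) \<le> d * (1 / sqrt ?n)"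
      using d n by (subst (asm) power_mono_iff) auto
    also have "\<dots> \<le> d * h" using h' d by (intro mult_left_mono) auto
    also have "\<dots> = shadow (f ` D) (f (G *v \<theta>))"
      using shadow_linear_image[OF f(1) D(2), of "G *v \<theta>"] f(2) by (simp add: h_def)
    also have "\<dots> = measure (subspace_lborel (perp \<theta>)) (proj_perp \<theta> ` (f ` D))"
      unfolding G by (rule shadow_unit[OF \<theta> E])
    finally show ?thesis .
  qed
  \<comment> \<open>T first translates x0 to 0 and then applies F.\<close>
  define T where "T x = f x + f (- x0)" for x
  have TC: "T ` C = f ` D"
    by (simp add: T_def D_def image_image linear_add[OF f(1), symmetric] add.commute)
  have "affine_map T" unfolding affine_map_def T_def using f(1) by blast
  moreover have "measure lebesgue (T ` C) \<noteq> 0" using vol d v by (simp add: TC)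
  ultimately show ?thesis using lower by (intro exI[of _ T]) (simp add: TC vol)
qed

end
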